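(* There exists no function $F:[0,+\infty)\to[0,+\infty)$ which grows less than linearly (that is, with $F(t)/t\to 0$ as $t\to+\infty$) such that $\log K(f_\varphi)\leq F(\|\varphi\|_{cr})$ for every minimal Lagrangian extension $f_\varphi:\mathbb{H}^2\to\mathbb{H}^2$ of a quasisymmetric homeomorphism $\varphi:\mathbb{R}\mathrm{P}^1\to\mathbb{R}\mathrm{P}^1$.
   Context: $\mathbb{H}^2$ is the hyperbolic plane in the upper half-plane model $\{z=x+iy: y>0\}$ with metric $g_{\mathbb{H}^2}=(dx^2+dy^2)/y^2$; its boundary at infinity is $\mathbb{R}\mathrm{P}^1\cong\mathbb{R}\cup\{\infty\}$. Cross-ratio: $cr(x_1,x_2,x_3,x_4)=\frac{(x_4-x_1)(x_3-x_2)}{(x_2-x_1)(x_3-x_4)}$ for quadruples of points of $\mathbb{R}\mathrm{P}^1$ (extended to $\infty$ by continuity). For an orientation-preserving homeomorphism $\varphi$ of $\mathbb{R}\mathrm{P}^1$, the cross-ratio norm is $\|\varphi\|_{cr}=\sup_{cr(Q)=-1}|\log|cr(\varphi(Q))||$, the supremum being over quadruples $Q$ with $cr(Q)=-1$; $\varphi$ is quasisymmetric if $\|\varphi\|_{cr}<+\infty$. For an orientation-preserving diffeomorphism $f:\mathbb{H}^2\to\mathbb{H}^2$, its maximal dilatation is $K(f)=\sup_{z\in\mathbb{H}^2}\frac{\text{major axis of }df_z(\mathbb{S}^1)}{\text{minor axis of }df_z(\mathbb{S}^1)}$, where $\mathbb{S}^1$ is the unit circle in $T_z\mathbb{H}^2=\mathbb{C}$;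 $f$ is quasiconformal if $K(f)<+\infty$. An orientation-preserving diffeomorphism $f:\mathbb{H}^2\to\mathbb{H}^2$ is minimal Lagrangian if it is area-preserving and its graph is a minimal surface in the Riemannian product $\mathbb{H}^2\times\mathbb{H}^2$. Equivalently, $f^*g_{\mathbb{H}^2}=g_{\mathbb{H}^2}(b\cdot,b\cdot)$ for some section $b$ of $\mathrm{End}(T\mathbb{H}^2)$ which is self-adjoint for $g_{\mathbb{H}^2}$, has $\det b=1$ and satisfies $d^\nabla b=0$, where $(d^\nabla b)(v,w)=\nabla_v(b(w))-\nabla_w(b(v))-b[v,w]$ and $\nabla$ is the Levi-Civita connection of $g_{\mathbb{H}^2}$. By a theorem of Bonsante and Schlenker, every quasisymmetric homeomorphism $\varphi$ of $\mathbb{R}\mathrm{P}^1$ has a unique minimal Lagrangian diffeomorphism $f_\varphi:\mathbb{H}^2\to\mathbb{H}^2$ extending it continuously, and $f_\varphi$ is quasiconformal. *)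

theory Defs
  imports "HOL-Analysis.Analysis" "HOL-Real_Asymp.Real_Asymp"
begin

section \<open>The projective line\<close>

text \<open>Points of the real projective line are \<^typ>\<open>real option\<close>, where \<^term>\<open>None\<close> is the point
  at infinity.\<close>

definition RP1 :: "real option topology" where
  "RP1 = Alexandroff_compactification euclideanreal"

text \<open>The cyclic order of the circle, obtained by cutting it at \<^term>\<open>None\<close>, which is placed
  at the top end. On distinct triples it is invariant under cyclic permutations.\<close>

definition rp1_cut :: "real option \<Rightarrow> ereal" where
  "rp1_cut p = (case p of None \<Rightarrow> \<infinity> | Some x \<Rightarrow> ereal x)"

definition cyclically_ordered :: "real option \<Rightarrow> real option \<Rightarrow> real option \<Rightarrow> bool" where
  "cyclically_ordered p q r \<longleftrightarrow>
     (rp1_cut p < rp1_cut q \<and> rp1_cut q < rp1_cut r) \<or>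
     (rp1_cut q < rp1_cut r \<and> rp1_cut r < rp1_cut p) \<or>
     (rp1_cut r < rp1_cut p \<and> rp1_cut p < rp1_cut q)"

definition orientation_preserving_homeo_RP1 :: "(real option \<Rightarrow> real option) \<Rightarrow> bool" where
  "orientation_preserving_homeo_RP1 \<phi> \<longleftrightarrow>
     homeomorphic_map RP1 RP1 \<phi> \<and>
     (\<forall>p q r. cyclically_ordered p q r \<longrightarrow> cyclically_ordered (\<phi> p) (\<phi> q) (\<phi> r))"

text \<open>\<open>rp1_diff p q\<close> is the determinant of the homogeneous coordinate vectors of \<open>p\<close> and \<open>q\<close>,
  with \<open>x\<close> represented by \<open>(x, 1)\<close> and infinity by \<open>(1, 0)\<close>. On finite points it is \<open>p - q\<close>,
  and the choice of representatives cancels in the cross-ratio.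
  The lemmas \<open>cross_ratio_Some\<close> and \<open>cross_ratio_limits\<close> below show that the result is the usual
  formula, extended to infinity by continuity.\<close>

fun rp1_diff :: "real option \<Rightarrow> real option \<Rightarrow> real" where
  "rp1_diff (Some x) (Some y) = x - y"
| "rp1_diff None (Some y) = 1"
| "rp1_diff (Some x) None = -1"
| "rp1_diff None None = 0"

definition cross_ratio :: "real option \<Rightarrow> real option \<Rightarrow> real option \<Rightarrow> real option \<Rightarrow> real" where
  "cross_ratio x1 x2 x3 x4 =
     (rp1_diff x4 x1 * rp1_diff x3 x2) / (rp1_diff x2 x1 * rp1_diff x3 x4)"

lemma cross_ratio_Some:
  "cross_ratio (Some x1) (Some x2) (Some x3) (Some x4) =
     ((x4 - x1) * (x3 - x2)) / ((x2 - x1) * (x3 - x4))"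
  by (simp add: cross_ratio_def)

lemma tendsto_diff_quotient_at_infinity:
  fixes a b :: real
  shows "((\<lambda>x. (x - a) / (x - b)) \<longlongrightarrow> 1) at_infinity"
    and "((\<lambda>x. (a - x) / (x - b)) \<longlongrightarrow> -1) at_infinity"
    and "((\<lambda>x. (x - a) / (b - x)) \<longlongrightarrow> -1) at_infinity"
    and "((\<lambda>x. (a - x) / (b - x)) \<longlongrightarrow> 1) at_infinity"
  unfolding at_infinity_eq_at_top_bot by (rule filterlim_sup; real_asymp)+

lemma cross_ratio_limits:
  "((\<lambda>x. cross_ratio (Some x) (Some x2) (Some x3) (Some x4)) \<longlongrightarrow>
      cross_ratio None (Some x2) (Some x3) (Some x4)) at_infinity"
  "((\<lambda>x. cross_ratio (Some x1) (Some x) (Some x3) (Some x4)) \<longlongrightarrow>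
      cross_ratio (Some x1) None (Some x3) (Some x4)) at_infinity"
  "((\<lambda>x. cross_ratio (Some x1) (Some x2) (Some x) (Some x4)) \<longlongrightarrow>
      cross_ratio (Some x1) (Some x2) None (Some x4)) at_infinity"
  "((\<lambda>x. cross_ratio (Some x1) (Some x2) (Some x3) (Some x)) \<longlongrightarrow>
      cross_ratio (Some x1) (Some x2) (Some x3) None) at_infinity"
  using tendsto_mult[OF tendsto_diff_quotient_at_infinity(4)[of x4 x2] tendsto_const[of "(x3 - x2) / (x3 - x4)"]]
    tendsto_mult[OF tendsto_diff_quotient_at_infinity(2)[of x3 x1] tendsto_const[of "(x4 - x1) / (x3 - x4)"]]
    tendsto_mult[OF tendsto_diff_quotient_at_infinity(1)[of x2 x4] tendsto_const[of "(x4 - x1) / (x2 - x1)"]]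
    tendsto_mult[OF tendsto_diff_quotient_at_infinity(3)[of x1 x3] tendsto_const[of "(x3 - x2) / (x2 - x1)"]]
    minus_divide_divide[of "x3 - x2" "x3 - x4"] minus_divide_divide[of "x2 - x3" "x2 - x1"]
  by (simp_all add: cross_ratio_def mult.commute)

lemma rp1_diff_self: "rp1_diff p p = 0"
  by (cases p) auto

lemma rp1_diff_swap: "rp1_diff q p = - rp1_diff p q"
  by (cases p; cases q) auto

text \<open>Division by zero does not produce spurious quadruples.\<close>

lemma cross_ratio_minus_one_distinct:
  assumes "cross_ratio x1 x2 x3 x4 = -1"
  shows "distinct [x1, x2, x3, x4]"
  using assms
proof -
  have "x1 \<noteq> x2" "x1 \<noteq> x4" "x2 \<noteq> x3" "x3 \<noteq> x4"
    using assms by (auto simp: cross_ratio_def rp1_diff_self)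
  moreover have "cross_ratio a b a c \<noteq> -1" for a b c
    unfolding cross_ratio_def rp1_diff_swap[of b a] rp1_diff_swap[of a c]
    by (simp add: mult.commute)
  then have "x1 \<noteq> x3"
    using assms by blast
  moreover have "cross_ratio a b c b \<noteq> -1" for a b c
    by (simp add: cross_ratio_def)
  then have "x2 \<noteq> x4"
    using assms by blast
  ultimately show ?thesis by simp
qed

definition cross_ratio_norm :: "(real option \<Rightarrow> real option) \<Rightarrow> ereal" where
  "cross_ratio_norm \<phi> =
     (SUP (x1, x2, x3, x4) \<in> {(x1, x2, x3, x4). cross_ratio x1 x2 x3 x4 = -1}.
        ereal \<bar>ln \<bar>cross_ratio (\<phi> x1) (\<phi> x2) (\<phi> x3) (\<phi> x4)\<bar>\<bar>)"

definition quasisymmetric :: "(real option \<Rightarrow> real option) \<Rightarrow> bool" where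
  "quasisymmetric \<phi> \<longleftrightarrow> orientation_preserving_homeo_RP1 \<phi> \<and> cross_ratio_norm \<phi> < \<infinity>"


section \<open>The hyperbolic plane\<close>

definition H2 :: "complex set" where
  "H2 = {z. 0 < Im z}"

definition hyp_metric :: "complex \<Rightarrow> complex \<Rightarrow> complex \<Rightarrow> real" where
  "hyp_metric z v w = (v \<bullet> w) / (Im z)\<^sup>2"

text \<open>The area form: \<^term>\<open>Im (cnj v * w)\<close> is the determinant of the pair \<open>(v, w)\<close>.\<close>

definition hyp_area_form :: "complex \<Rightarrow> complex \<Rightarrow> complex \<Rightarrow> real" where
  "hyp_area_form z v w = Im (cnj v * w) / (Im z)\<^sup>2"

text \<open>The Christoffel symbols \<open>\<Gamma>\<^sup>x\<^sub>x\<^sub>y = \<Gamma>\<^sup>y\<^sub>y\<^sub>y = -1/y\<close>, \<open>\<Gamma>\<^sup>y\<^sub>x\<^sub>x = 1/y\<close> (the others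
  vanish) of the Levi-Civita connection, as a symmetric bilinear map. The two lemmas
  state that the connection is torsion-free and compatible with the metric.\<close>

definition hyp_christoffel :: "complex \<Rightarrow> complex \<Rightarrow> complex \<Rightarrow> complex" where
  "hyp_christoffel z v w = \<i> * v * w / of_real (Im z)"

lemma hyp_christoffel_sym: "hyp_christoffel z v w = hyp_christoffel z w v"
  by (simp add: hyp_christoffel_def)

lemma hyp_christoffel_metric:
  assumes "z \<in> H2"
  shows "((\<lambda>z. hyp_metric z v w) has_derivative
           (\<lambda>u. hyp_metric z (hyp_christoffel z u v) w + hyp_metric z v (hyp_christoffel z u w))) (at z)"
proof -
  have y: "Im z \<noteq> 0" using assms by (simp add: H2_def)
  have sq: "((\<lambda>z. (Im z)\<^sup>2) has_derivative (\<lambda>u. 2 * Im z * Im u)) (at z)"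
    by (auto intro!: derivative_eq_intros)
  have "((\<lambda>z. hyp_metric z v w) has_derivative (\<lambda>u. - (v \<bullet> w) * (2 * Im z * Im u) / ((Im z)\<^sup>2)\<^sup>2)) (at z)"
    unfolding hyp_metric_def
    using has_derivative_divide'[OF has_derivative_const[of "v \<bullet> w"] sq] y
    by (simp add: power2_eq_square)
  moreover have "- (v \<bullet> w) * (2 * Im z * Im u) / ((Im z)\<^sup>2)\<^sup>2 =
      hyp_metric z (hyp_christoffel z u v) w + hyp_metric z v (hyp_christoffel z u w)" for u
  proof -
    have "hyp_metric z (hyp_christoffel z u v) w + hyp_metric z v (hyp_christoffel z u w)
        = ((\<i> * u * v) \<bullet> w + v \<bullet> (\<i> * u * w)) / Im z / (Im z)\<^sup>2"
      by (simp add: hyp_metric_def hyp_christoffel_def inner_complex_def add_divide_distrib)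
    also have "(\<i> * u * v) \<bullet> w + v \<bullet> (\<i> * u * w) = - 2 * Im u * (v \<bullet> w)"
      by (simp add: inner_complex_def algebra_simps)
    also have "- 2 * Im u * (v \<bullet> w) / Im z / (Im z)\<^sup>2 = - (v \<bullet> w) * (2 * Im z * Im u) / ((Im z)\<^sup>2)\<^sup>2"
      using y by (simp add: power2_eq_square)
    finally show ?thesis by simp
  qed
  ultimately show ?thesis by simp
qed

primrec Ck_on :: "nat \<Rightarrow> ('a::real_normed_vector \<Rightarrow> 'b::real_normed_vector) \<Rightarrow> 'a set \<Rightarrow> bool" where
  "Ck_on 0 f S \<longleftrightarrow> continuous_on S f"
| "Ck_on (Suc k) f S \<longleftrightarrow>
     (\<forall>x\<in>S. f differentiable (at x)) \<and> (\<forall>v. Ck_on k (\<lambda>x. frechet_derivative f (at x) v) S)"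

definition smooth_on_open :: "('a::real_normed_vector \<Rightarrow> 'b::real_normed_vector) \<Rightarrow> 'a set \<Rightarrow> bool" where
  "smooth_on_open f S \<longleftrightarrow> open S \<and> (\<forall>k. Ck_on k f S)"

definition diffeomorphism_H2 :: "(complex \<Rightarrow> complex) \<Rightarrow> bool" where
  "diffeomorphism_H2 f \<longleftrightarrow>
     bij_betw f H2 H2 \<and> smooth_on_open f H2 \<and> smooth_on_open (inv_into H2 f) H2"

abbreviation diff_at :: "('a::real_normed_vector \<Rightarrow> 'b::real_normed_vector) \<Rightarrow> 'a \<Rightarrow> 'a \<Rightarrow> 'b" where
  "diff_at f z \<equiv> frechet_derivative f (at z)"

definition orientation_preserving_H2 :: "(complex \<Rightarrow> complex) \<Rightarrow> bool" where
  "orientation_preserving_H2 f \<longleftrightarrow>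
     (\<forall>z\<in>H2. hyp_area_form (f z) (diff_at f z 1) (diff_at f z \<i>) > 0)"

definition area_preserving_H2 :: "(complex \<Rightarrow> complex) \<Rightarrow> bool" where
  "area_preserving_H2 f \<longleftrightarrow>
     (\<forall>z\<in>H2. \<forall>v w. hyp_area_form (f z) (diff_at f z v) (diff_at f z w) = hyp_area_form z v w)"


section \<open>Maximal dilatation\<close>

text \<open>Axes of an ellipse centred at the origin.\<close>

definition major_axis :: "complex set \<Rightarrow> real" where
  "major_axis E = 2 * (SUP w\<in>E. norm w)"

definition minor_axis :: "complex set \<Rightarrow> real" where
  "minor_axis E = 2 * (INF w\<in>E. norm w)"

definition max_dilatation :: "(complex \<Rightarrow> complex) \<Rightarrow> ereal" where
  "max_dilatation f =
     (SUP z\<in>H2. ereal (major_axis (diff_at f z ` sphere 0 1) / minor_axis (diff_at f z ` sphere 0 1)))"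

text \<open>Logarithm of a positive extended real.\<close>

definition ereal_ln :: "ereal \<Rightarrow> ereal" where
  "ereal_ln x = (if x = \<infinity> then \<infinity> else ereal (ln (real_of_ereal x)))"


section \<open>Minimal Lagrangian diffeomorphisms\<close>

text \<open>The Riemannian product of two hyperbolic planes; its Levi-Civita connection acts
  componentwise.\<close>

definition prod_metric :: "complex \<times> complex \<Rightarrow> complex \<times> complex \<Rightarrow> complex \<times> complex \<Rightarrow> real" where
  "prod_metric p V W =
     hyp_metric (fst p) (fst V) (fst W) + hyp_metric (snd p) (snd V) (snd W)"

definition prod_christoffel ::
    "complex \<times> complex \<Rightarrow> complex \<times> complex \<Rightarrow> complex \<times> complex \<Rightarrow> complex \<times> complex" where
  "prod_christoffel p V W =
     (hyp_christoffel (fst p) (fst V) (fst W), hyp_christoffel (snd p) (snd V) (snd W))"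

text \<open>For a surface \<open>\<iota>\<close> parametrised by a plane domain, \<open>cov_second_deriv \<iota> z v w\<close> is
  \<open>\<nabla>\<^sub>v (d\<iota>(w))\<close> for the constant vector fields \<open>v\<close> and \<open>w\<close>. Its inner product with a normal
  vector is the second fundamental form in that direction, and the mean curvature in that
  direction is the trace of the latter over an orthonormal tangent frame.\<close>

definition cov_second_deriv ::
    "(complex \<Rightarrow> complex \<times> complex) \<Rightarrow> complex \<Rightarrow> complex \<Rightarrow> complex \<Rightarrow> complex \<times> complex" where
  "cov_second_deriv \<iota> z v w =
     diff_at (\<lambda>x. diff_at \<iota> x w) z v + prod_christoffel (\<iota> z) (diff_at \<iota> z v) (diff_at \<iota> z w)"

definition normal_vector :: "(complex \<Rightarrow> complex \<times> complex) \<Rightarrow> complex \<Rightarrow> complex \<times> complex \<Rightarrow> bool" where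
  "normal_vector \<iota> z N \<longleftrightarrow> (\<forall>v. prod_metric (\<iota> z) (diff_at \<iota> z v) N = 0)"

definition second_fundamental_form ::
    "(complex \<Rightarrow> complex \<times> complex) \<Rightarrow> complex \<Rightarrow> complex \<times> complex \<Rightarrow> complex \<Rightarrow> complex \<Rightarrow> real" where
  "second_fundamental_form \<iota> z N v w = prod_metric (\<iota> z) (cov_second_deriv \<iota> z v w) N"

definition orthonormal_frame :: "(complex \<Rightarrow> complex \<times> complex) \<Rightarrow> complex \<Rightarrow> complex \<Rightarrow> complex \<Rightarrow> bool" where
  "orthonormal_frame \<iota> z e1 e2 \<longleftrightarrow>
     prod_metric (\<iota> z) (diff_at \<iota> z e1) (diff_at \<iota> z e1) = 1 \<and>
     prod_metric (\<iota> z) (diff_at \<iota> z e2) (diff_at \<iota> z e2) = 1 \<and>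
     prod_metric (\<iota> z) (diff_at \<iota> z e1) (diff_at \<iota> z e2) = 0"

definition graph_map :: "(complex \<Rightarrow> complex) \<Rightarrow> complex \<Rightarrow> complex \<times> complex" where
  "graph_map f z = (z, f z)"

definition minimal_graph :: "(complex \<Rightarrow> complex) \<Rightarrow> bool" where
  "minimal_graph f \<longleftrightarrow>
     (\<forall>z\<in>H2. \<forall>N e1 e2.
        normal_vector (graph_map f) z N \<and> orthonormal_frame (graph_map f) z e1 e2 \<longrightarrow>
        second_fundamental_form (graph_map f) z N e1 e1 +
        second_fundamental_form (graph_map f) z N e2 e2 = 0)"

definition minimal_lagrangian :: "(complex \<Rightarrow> complex) \<Rightarrow> bool" where
  "minimal_lagrangian f \<longleftrightarrow>
     diffeomorphism_H2 f \<and> orientation_preserving_H2 f \<and> area_preserving_H2 f \<and> minimal_graph f"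


section \<open>Continuous extension to the boundary\<close>

text \<open>The closed disc \<open>H2 \<union> RP1\<close>, as a subspace of the Riemann sphere.\<close>

definition closed_H2 :: "complex option topology" where
  "closed_H2 = subtopology (Alexandroff_compactification euclidean) (insert None (Some ` {z. 0 \<le> Im z}))"

definition glue :: "(complex \<Rightarrow> complex) \<Rightarrow> (real option \<Rightarrow> real option) \<Rightarrow> complex option \<Rightarrow> complex option" where
  "glue f \<phi> p =
     (case p of
        None \<Rightarrow> map_option complex_of_real (\<phi> None)
      | Some z \<Rightarrow> if z \<in> H2 then Some (f z) else map_option complex_of_real (\<phi> (Some (Re z))))"

definition extends_continuously :: "(complex \<Rightarrow> complex) \<Rightarrow> (real option \<Rightarrow> real option) \<Rightarrow> bool" where
  "extends_continuously f \<phi> \<longleftrightarrow> continuous_map closed_H2 closed_H2 (glue f \<phi>)"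

end

theory Submission
  imports Defs
begin

text \<open>
  Consider the diffeomorphisms \<open>f(z) = z exp(T(\<theta>))\<close> with \<open>\<theta> = arg z\<close>, which commute with the
  hyperbolic translations \<open>z \<mapsto> \<lambda> z\<close>. In the coordinates \<open>s + i\<theta> = log z\<close> they are the shears
  \<open>(s, \<theta>) \<mapsto> (s + T(\<theta>), \<theta>)\<close>, hence they preserve the area, and their graph is minimal iff
  \<open>\<tau> = T'\<close> solves \<open>2 \<tau>' = cot \<theta> \<tau> (4 + \<tau>\<^sup>2)\<close>. The solutions are
  \<open>\<tau> = - 2 k sin\<^sup>2 \<theta> / sqrt (1 - k\<^sup>2 sin\<^sup>4 \<theta>)\<close> with \<open>\<bar>k\<bar> < 1\<close>. The boundary map is linear on
  each half-line, with slopes \<open>exp L\<close> and \<open>exp (- L)\<close>, so its cross-ratio norm lies between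
  \<open>2 L\<close> and \<open>4 L\<close>. As \<open>\<epsilon> = sqrt (1 - k\<^sup>2)\<close> tends to \<open>0\<close>, the dilatation on the axis
  \<open>\<theta> = \<pi>/2\<close> is at least \<open>2 k / \<epsilon>\<close>, while \<open>L\<close> tends to infinity no faster than a multiple
  of \<open>ln (1 / \<epsilon>)\<close>.
\<close>

section \<open>One-point compactifications, smoothness criteria, orthonormal frames\<close>

lemma continuous_map_Alexandroff_map_option:
  fixes g h :: "'a::t2_space \<Rightarrow> 'a"
  assumes g: "continuous_on UNIV g" and h: "continuous_on UNIV h"
    and hg: "\<And>x. h (g x) = x" and gh: "\<And>x. g (h x) = x"
  shows "continuous_map (Alexandroff_compactification euclidean)
           (Alexandroff_compactification euclidean) (map_option g)"
  unfolding continuous_map_alt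
proof (intro conjI allI impI)
  show "map_option g \<in> topspace (Alexandroff_compactification euclidean)
          \<rightarrow> topspace (Alexandroff_compactification euclidean)"
    by (simp flip: UNIV_option_conv)
next
  fix U :: "'a option set"
  assume "openin (Alexandroff_compactification euclidean) U"
  then consider V where "open V" "U = Some ` V"
    | C where "compact C" "U = insert None (Some ` (UNIV - C))"
    unfolding openin_Alexandroff_compactification by auto
  then show "openin (Alexandroff_compactification euclidean)
      (map_option g -` U \<inter> topspace (Alexandroff_compactification euclidean))"
  proof cases
    case 1
    have "map_option g -` U \<inter> topspace (Alexandroff_compactification euclidean) = Some ` (g -` V)"
      using 1 by (auto simp flip: UNIV_option_conv)
    then show ?thesis using 1 g by (simp add: open_vimage)
  next
    case 2
    have "map_option g -` U \<inter> topspace (Alexandroff_compactification euclidean)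
        = insert None (Some ` (UNIV - h ` C))"
    proof -
      have "a \<in> h ` C \<longleftrightarrow> g a \<in> C" for a
        using hg gh by (metis imageE imageI)
      then show ?thesis
        unfolding 2 UNIV_option_conv[symmetric] topspace_Alexandroff_compactification topspace_euclidean
        by (intro set_eqI, rename_tac p, case_tac p) auto
    qed
    moreover have "compact (h ` C)"
      using 2 h by (meson compact_continuous_image continuous_on_subset subset_UNIV)
    ultimately show ?thesis
      unfolding openin_Alexandroff_compactification
      by (intro disjI2 exI[of _ "h ` C"]) (simp add: compact_imp_closed)
  qed
qed

lemma Ck_on_cong:
  assumes "open S" "\<And>x. x \<in> S \<Longrightarrow> f x = g x" "Ck_on k f S"
  shows "Ck_on k g S"
  using assms(2,3)
proof (induction k arbitrary: f g)
  case 0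
  then show ?case by (simp cong: continuous_on_cong)
next
  case (Suc k)
  have d: "f differentiable (at x)" if "x \<in> S" for x
    using Suc.prems that by simp
  have eq: "frechet_derivative f (at x) = frechet_derivative g (at x)" if "x \<in> S" for x
    using frechet_derivative_transform_within_open[OF d[OF that] \<open>open S\<close> that] Suc.prems(1) by blast
  have "g differentiable (at x)" if x: "x \<in> S" for x
  proof -
    obtain D where "(f has_derivative D) (at x)" using d[OF x] by (auto simp: differentiable_def)
    then have "(g has_derivative D) (at x)"
      by (rule has_derivative_transform_within_open[OF _ \<open>open S\<close> x Suc.prems(1)])
    then show ?thesis by (auto simp: differentiable_def)
  qed
  moreover have "Ck_on k (\<lambda>x. frechet_derivative g (at x) v) S" for v
    by (rule Suc.IH[of "\<lambda>x. frechet_derivative f (at x) v"]) (use Suc.prems(2) eq in simp_all)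
  ultimately show ?case by simp
qed

text \<open>\<open>Ck_on\<close> recurses through directional derivatives, so any class of
  differentiable functions closed under them is smooth, and no higher derivative has to be computed.
  The members of \<open>P\<close> are global functions, while the derivatives are known on
  \<open>S\<close> alone; \<open>Ck_on_cong\<close> bridges the two.\<close>

lemma smooth_on_open_coinduct:
  assumes S: "open S" and f: "P f"
    and step: "\<And>f. P f \<Longrightarrow> \<exists>f'. (\<forall>x\<in>S. (f has_derivative f' x) (at x)) \<and> (\<forall>v. P (\<lambda>x. f' x v))"
  shows "smooth_on_open f S"
proof -
  have "Ck_on k f S" if "P f" for k f
    using that
  proof (induction k arbitrary: f)
    case 0
    then show ?case
      using step[OF 0] by (auto intro: continuous_at_imp_continuous_on has_derivative_continuous)
  next
    case (Suc k)
    obtain f' where f': "\<And>x. x \<in> S \<Longrightarrow> (f has_derivative f' x) (at x)" "\<And>v. P (\<lambda>x. f' x v)"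
      using step[OF Suc.prems] by blast
    have "Ck_on k (\<lambda>x. frechet_derivative f (at x) v) S" for v
      by (rule Ck_on_cong[OF S _ Suc.IH[OF f'(2)[of v]]]) (simp add: frechet_derivative_at[OF f'(1)])
    then show ?case using f'(1) by (auto simp: differentiable_def)
  qed
  then show ?thesis using S f by (simp add: smooth_on_open_def)
qed

lemma smooth_on_open_cong:
  assumes "\<And>x. x \<in> S \<Longrightarrow> f x = g x" "smooth_on_open f S"
  shows "smooth_on_open g S"
  using assms Ck_on_cong[of S f g] by (auto simp: smooth_on_open_def)

text \<open>If the columns of \<open>X\<close> are orthonormal for the form \<open>M\<close> with entries \<open>p, q, r\<close>, then
  \<open>X X\<^sup>T = M\<^sup>-\<^sup>1\<close>.\<close>

lemma orthonormal_frame_dual: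
  fixes p q r :: real
  assumes e1: "p * a1\<^sup>2 + 2 * q * a1 * b1 + r * b1\<^sup>2 = 1"
    and e2: "p * a2\<^sup>2 + 2 * q * a2 * b2 + r * b2\<^sup>2 = 1"
    and e12: "p * a1 * a2 + q * (a1 * b2 + b1 * a2) + r * b1 * b2 = 0"
  shows "(p * r - q\<^sup>2) * (a1\<^sup>2 + a2\<^sup>2) = r"
    and "(p * r - q\<^sup>2) * (a1 * b1 + a2 * b2) = - q"
    and "(p * r - q\<^sup>2) * (b1\<^sup>2 + b2\<^sup>2) = p"
proof -
  define d where "d = a1 * b2 - a2 * b1"
  define D where "D = p * r - q\<^sup>2"
  \<comment> \<open>The Gram determinant of two vectors is the determinant of the form times the
    squared determinant of the vectors.\<close>
  have "D * d\<^sup>2 = (p * a1\<^sup>2 + 2 * q * a1 * b1 + r * b1\<^sup>2) * (p * a2\<^sup>2 + 2 * q * a2 * b2 + r * b2\<^sup>2)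
      - (p * a1 * a2 + q * (a1 * b2 + b1 * a2) + r * b1 * b2)\<^sup>2"
    unfolding D_def d_def by algebra
  then have Dd: "D * d\<^sup>2 = 1" using assms by simp
  \<comment> \<open>The second vector is \<open>M\<close>-orthogonal to the first, hence
    proportional to the quarter turn of \<open>M\<close> applied to the first; the unit length of
    the first makes \<open>d\<close> the factor.\<close>
  have "d * (p * a1 + q * b1) = b2" "d * (q * a1 + r * b1) = - a2"
    using assms unfolding d_def by algebra+
  then have u: "b2 = d * (p * a1 + q * b1)" "a2 = - d * (q * a1 + r * b1)" by auto
  have "r * (p * a1\<^sup>2 + 2 * q * a1 * b1 + r * b1\<^sup>2) = D * a1\<^sup>2 + (q * a1 + r * b1)\<^sup>2"
    "p * (p * a1\<^sup>2 + 2 * q * a1 * b1 + r * b1\<^sup>2) = D * b1\<^sup>2 + (p * a1 + q * b1)\<^sup>2"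
    "q * (p * a1\<^sup>2 + 2 * q * a1 * b1 + r * b1\<^sup>2) = - D * a1 * b1 + (p * a1 + q * b1) * (q * a1 + r * b1)"
    unfolding D_def by algebra+
  then have "r = D * a1\<^sup>2 + (q * a1 + r * b1)\<^sup>2" "p = D * b1\<^sup>2 + (p * a1 + q * b1)\<^sup>2"
    "q = - D * a1 * b1 + (p * a1 + q * b1) * (q * a1 + r * b1)"
    using e1 by simp_all
  moreover have "(q * a1 + r * b1)\<^sup>2 = D * a2\<^sup>2" "(p * a1 + q * b1)\<^sup>2 = D * b2\<^sup>2"
    "(p * a1 + q * b1) * (q * a1 + r * b1) = - D * a2 * b2"
    using Dd u by algebra+
  ultimately have "r = D * a1\<^sup>2 + D * a2\<^sup>2" "p = D * b1\<^sup>2 + D * b2\<^sup>2" "q = - D * a1 * b1 - D * a2 * b2"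
    by simp_all
  then show "(p * r - q\<^sup>2) * (a1\<^sup>2 + a2\<^sup>2) = r"
    and "(p * r - q\<^sup>2) * (a1 * b1 + a2 * b2) = - q"
    and "(p * r - q\<^sup>2) * (b1\<^sup>2 + b2\<^sup>2) = p"
    unfolding D_def by (simp_all add: algebra_simps)
qed

section \<open>Equivariant shears\<close>

text \<open>The angle \<open>\<theta>\<close> is replaced by the variable \<open>w = cos \<theta> = Re z / norm z\<close>, so that the boundary
  half-lines are \<open>w = 1\<close> and \<open>w = -1\<close>; \<open>shear_density\<close> is \<open>dT/dw\<close>. The truncation \<open>max 0\<close> only
  serves to make it continuous on the whole line. At \<open>z = 0\<close>, \<open>w\<close> has the junk value \<open>0\<close>.\<close>

definition shear_density :: "real \<Rightarrow> real \<Rightarrow> real" where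
  "shear_density k w =
     2 * k * sqrt (max 0 (1 - w\<^sup>2)) / sqrt (1 - k\<^sup>2 * (max 0 (1 - w\<^sup>2))\<^sup>2)"

text \<open>For \<open>\<bar>k\<bar> < 1\<close> the density is continuous, so such a primitive
  exists and is unique, and the choice is harmless. Vanishing at 0 means that the imaginary axis is
  fixed pointwise.\<close>

definition shear :: "real \<Rightarrow> real \<Rightarrow> real" where
  "shear k = (SOME F. F 0 = 0 \<and> (\<forall>w. (F has_real_derivative shear_density k w) (at w)))"

definition shear_map :: "real \<Rightarrow> complex \<Rightarrow> complex" where
  "shear_map k z = z * of_real (exp (shear k (Re z / norm z)))"

lemma one_minus_square_times_pos:
  fixes k m :: real
  assumes "\<bar>k\<bar> < 1" "0 \<le> m" "m \<le> 1"
  shows "0 < 1 - k\<^sup>2 * m\<^sup>2"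
proof -
  have "k\<^sup>2 < 1" using assms(1) by (simp add: abs_square_less_1)
  moreover have "m\<^sup>2 \<le> 1" using assms(2,3) by (simp add: abs_square_le_1)
  ultimately have "k\<^sup>2 * m\<^sup>2 < 1"
    using mult_left_le[of "m\<^sup>2" "k\<^sup>2"] by simp
  then show ?thesis by simp
qed

lemma shear_density_denom_pos:
  fixes k w :: real
  assumes "\<bar>k\<bar> < 1"
  shows "0 < 1 - k\<^sup>2 * (max 0 (1 - w\<^sup>2))\<^sup>2"
  by (rule one_minus_square_times_pos) (use assms in auto)

lemma isCont_shear_density:
  assumes "\<bar>k\<bar> < 1"
  shows "isCont (shear_density k) w"
  unfolding shear_density_def using shear_density_denom_pos[OF assms, of w]
  by (intro continuous_intros) auto

lemma shear_antiderivative: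
  assumes "\<bar>k\<bar> < 1"
  shows "shear k 0 = 0" and "(shear k has_real_derivative shear_density k w) (at w)"
proof -
  have "\<exists>F. \<forall>w. (F has_real_derivative shear_density k w) (at w)"
    using einterval_antiderivative[of "-\<infinity>" "\<infinity>" "shear_density k"] isCont_shear_density[OF assms]
    by (simp add: has_real_derivative_iff_has_vector_derivative)
  then obtain F where F: "\<And>w. (F has_real_derivative shear_density k w) (at w)" by blast
  have "\<exists>F. F 0 = 0 \<and> (\<forall>w. (F has_real_derivative shear_density k w) (at w))"
  proof (intro exI conjI allI)
    show "((\<lambda>w. F w - F 0) has_real_derivative shear_density k w) (at w)" for w
      using F[of w] by (auto intro!: derivative_eq_intros)
  qed simp
  from someI_ex[OF this] show "shear k 0 = 0" "(shear k has_real_derivative shear_density k w) (at w)"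
    unfolding shear_def by blast+
qed

text \<open>Transfers symmetries of the density to its primitive: \<open>shear_density\<close> is
  odd in \<open>k\<close> and even in \<open>w\<close>, whence \<open>shear\<close> is odd in each
  argument.\<close>

lemma shear_unique:
  assumes k: "\<bar>k\<bar> < 1"
    and F: "F 0 = 0" "\<And>w. (F has_real_derivative shear_density k w) (at w)"
  shows "shear k = F"
proof
  fix w
  have "((\<lambda>w. shear k w - F w) has_real_derivative 0) (at w)" for w
    using DERIV_diff[OF shear_antiderivative(2)[OF k] F(2)] by simp
  then have "shear k w - F w = shear k 0 - F 0"
    by (intro DERIV_isconst_all) blast
  then show "shear k w = F w" using F(1) shear_antiderivative(1)[OF k] by simp
qed

lemma shear_minus_left:
  assumes "\<bar>k\<bar> < 1" shows "shear (- k) w = - shear k w"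
proof -
  have "((\<lambda>w. - shear k w) has_real_derivative shear_density (- k) w) (at w)" for w
    using DERIV_minus[OF shear_antiderivative(2)[OF assms]] by (simp add: shear_density_def)
  then have "shear (- k) = (\<lambda>w. - shear k w)"
    using assms shear_antiderivative(1)[OF assms] by (intro shear_unique) auto
  then show ?thesis by simp
qed

lemma shear_minus_right:
  assumes "\<bar>k\<bar> < 1" shows "shear k (- w) = - shear k w"
proof -
  have "((\<lambda>w. - shear k (- w)) has_real_derivative shear_density k w) (at w)" for w
  proof -
    have "(uminus has_real_derivative - 1) (at w)" by (auto intro!: derivative_eq_intros)
    from DERIV_minus[OF DERIV_chain2[OF shear_antiderivative(2)[OF assms] this]] show ?thesis
      by (simp add: shear_density_def)
  qed
  then have "shear k = (\<lambda>w. - shear k (- w))"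
    using assms shear_antiderivative(1)[OF assms] by (intro shear_unique) auto
  then have "shear k (- w) = - shear k (- (- w))" by (rule fun_cong)
  then show ?thesis by simp
qed

lemma isCont_shear: "\<bar>k\<bar> < 1 \<Longrightarrow> isCont (shear k) w"
  using shear_antiderivative(2) DERIV_isCont by blast

lemma Re_shear_map [simp]: "Re (shear_map k z) = Re z * exp (shear k (Re z / norm z))"
  and Im_shear_map [simp]: "Im (shear_map k z) = Im z * exp (shear k (Re z / norm z))"
  by (simp_all add: shear_map_def)

text \<open>Multiplication by a positive real keeps the angle, so the second map sees the same
  \<open>w\<close> and applies the reciprocal factor.\<close>

lemma shear_map_inverse:
  assumes "\<bar>k\<bar> < 1" shows "shear_map (- k) (shear_map k z) = z"
proof -
  have "Re (shear_map k z) / norm (shear_map k z) = Re z / norm z"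
    by (simp add: shear_map_def norm_mult)
  then show ?thesis
    by (simp add: shear_map_def[of "-k"] shear_minus_left[OF assms])
       (simp add: shear_map_def exp_minus flip: of_real_mult)
qed

lemma shear_map_inverse':
  assumes "\<bar>k\<bar> < 1" shows "shear_map k (shear_map (- k) z) = z"
  using shear_map_inverse[of "- k"] assms by simp

text \<open>The whole plane is used as domain so that the boundary values on the real axis and the
  extension to the Riemann sphere come from the same map.\<close>

lemma continuous_on_shear_map:
  assumes "\<bar>k\<bar> < 1" shows "continuous_on UNIV (shear_map k)"
proof -
  have "isCont (shear_map k) z" for z
  proof (cases "z = 0")
    case False
    then show ?thesis
      unfolding shear_map_def
      by (intro continuous_intros isCont_o2[OF _ isCont_shear[OF assms]]) auto
  next
    \<comment> \<open>The angle has no limit at 0, but \<open>w\<close> stays in the compact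
      interval from -1 to 1, where \<open>shear k\<close> is bounded; so the image is at most a
      constant times \<open>norm z\<close>.\<close>
    case True
    have "compact (shear k ` {-1..1})"
      by (intro compact_continuous_image continuous_at_imp_continuous_on ballI isCont_shear[OF assms] compact_Icc)
    then obtain B where B: "\<And>w. w \<in> {-1..1} \<Longrightarrow> \<bar>shear k w\<bar> \<le> B"
      by (metis bounded_iff compact_imp_bounded image_eqI real_norm_def)
    have bound: "norm (shear_map k z) \<le> norm z * exp B" for z
    proof -
      have "\<bar>Re z / norm z\<bar> \<le> 1"
        using abs_Re_le_cmod[of z] by (cases "z = 0") (auto simp: divide_simps)
      then have "Re z / norm z \<in> {-1..1}"
        unfolding atLeastAtMost_iff abs_le_iff by linarith
      then have "\<bar>shear k (Re z / norm z)\<bar> \<le> B" by (rule B)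
      then show ?thesis
        by (simp add: shear_map_def norm_mult mult_left_mono)
    qed
    have "((\<lambda>z. norm z * exp B) \<longlongrightarrow> 0) (at 0)"
      by (auto intro!: tendsto_eq_intros)
    then have "(shear_map k \<longlongrightarrow> 0) (at 0)"
      by (rule Lim_null_comparison[rotated]) (simp add: bound)
    then show ?thesis unfolding True isCont_def by (simp add: shear_map_def)
  qed
  then show ?thesis by (simp add: continuous_at_imp_continuous_on)
qed

lemma shear_map_in_H2 [simp]: "shear_map k z \<in> H2 \<longleftrightarrow> z \<in> H2"
  by (simp add: H2_def zero_less_mult_iff)

lemma bij_betw_shear_map:
  assumes "\<bar>k\<bar> < 1" shows "bij_betw (shear_map k) H2 H2"
  by (rule bij_betw_byWitness[where f' = "shear_map (- k)"])
     (auto simp: shear_map_inverse[OF assms] shear_map_inverse'[OF assms])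

lemma inv_into_shear_map:
  assumes "\<bar>k\<bar> < 1" "z \<in> H2" shows "inv_into H2 (shear_map k) z = shear_map (- k) z"
  using assms bij_betw_shear_map[OF assms(1)]
  by (intro inv_into_f_eq) (auto simp: bij_betw_def shear_map_inverse')

text \<open>\<open>twist k z\<close> is \<open>\<tau> = dT/d\<theta>\<close>, and \<open>Im (v / z)\<close> is \<open>d\<theta>(v)\<close>.\<close>

definition twist :: "real \<Rightarrow> complex \<Rightarrow> real" where
  "twist k z = - 2 * k * (Im z)\<^sup>2 / sqrt ((norm z) ^ 4 - k\<^sup>2 * (Im z) ^ 4)"

lemma Im_divide_complex: "Im (v / z) = (Im v * Re z - Re v * Im z) / (norm z)\<^sup>2"
  by (simp add: Im_divide cmod_power2)

lemma twist_denom_pos: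
  assumes "\<bar>k\<bar> < 1" "z \<noteq> 0" shows "0 < (norm z) ^ 4 - k\<^sup>2 * (Im z) ^ 4"
proof -
  define m where "m = (Im z)\<^sup>2 / (norm z)\<^sup>2"
  have "m \<le> 1" using assms by (simp add: m_def divide_simps cmod_power2 sum_power2_gt_zero_iff complex_neq_0)
  then have "0 < 1 - k\<^sup>2 * m\<^sup>2" using assms by (intro one_minus_square_times_pos) (auto simp: m_def)
  then have "0 < (norm z) ^ 4 * (1 - k\<^sup>2 * m\<^sup>2)" using assms by simp
  also have "\<dots> = (norm z) ^ 4 - k\<^sup>2 * (Im z) ^ 4"
    using assms by (simp add: m_def field_simps)
  finally show ?thesis .
qed

section \<open>Differentials of the shear angle and of the twist\<close>

text \<open>Chain rule: \<open>w = cos \<theta>\<close> has differential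
  \<open>- sin \<theta>\<close> times that of \<theta>, and \<open>shear_density\<close> at
  \<open>w\<close> times \<open>- sin \<theta>\<close> is \<open>twist\<close>.\<close>

lemma shear_angle_has_derivative:
  assumes k: "\<bar>k\<bar> < 1" and z: "z \<in> H2"
  shows "((\<lambda>z. shear k (Re z / norm z)) has_derivative (\<lambda>v. twist k z * Im (v / z))) (at z)"
proof -
  define r where "r = norm z"
  define x where "x = Re z"
  define y where "y = Im z"
  have z0: "z \<noteq> 0" and y: "y > 0" using z by (auto simp: H2_def y_def)
  then have r: "r > 0" by (simp add: r_def)
  have r2: "r\<^sup>2 = x\<^sup>2 + y\<^sup>2" by (simp add: r_def x_def y_def cmod_power2)
  have "(norm has_derivative (\<lambda>v. (x * Re v + y * Im v) / r)) (at z)"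
    using has_derivative_norm[OF z0]
    by (simp add: sgn_div_norm inner_complex_def r_def x_def y_def divide_inverse algebra_simps)
  then have D: "((\<lambda>z. Re z / norm z) has_derivative (\<lambda>v. (Re v * r - x * ((x * Re v + y * Im v) / r)) / r\<^sup>2)) (at z)"
    using has_derivative_divide'[OF has_derivative_Re[OF has_derivative_ident], of norm "\<lambda>v. (x * Re v + y * Im v) / r" z] z0
    unfolding r_def x_def power2_eq_square by simp
  have "(shear k has_derivative (*) (shear_density k (x / r))) (at (Re z / norm z))"
    using shear_antiderivative(2)[OF k, of "x / r"] by (simp add: has_field_derivative_def r_def x_def)
  from has_derivative_compose[OF D this]
  have D2: "((\<lambda>z. shear k (Re z / norm z)) has_derivative
       (\<lambda>v. shear_density k (x / r) * ((Re v * r - x * ((x * Re v + y * Im v) / r)) / r\<^sup>2))) (at z)" .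
  have m: "max 0 (1 - (x / r)\<^sup>2) = (y / r)\<^sup>2"
  proof -
    have "1 - (x / r)\<^sup>2 = (r\<^sup>2 - x\<^sup>2) / r\<^sup>2" using r by (simp add: field_simps)
    then have "1 - (x / r)\<^sup>2 = (y / r)\<^sup>2" unfolding r2 power_divide by simp
    then show ?thesis by simp
  qed
  have "shear_density k (x / r) = 2 * k * (y / r) / sqrt (1 - k\<^sup>2 * ((y / r)\<^sup>2)\<^sup>2)"
    unfolding shear_density_def m using y r by simp
  also have "1 - k\<^sup>2 * ((y / r)\<^sup>2)\<^sup>2 = (r ^ 4 - k\<^sup>2 * y ^ 4) / (r\<^sup>2)\<^sup>2"
    using r by (simp add: field_simps)
  also have "2 * k * (y / r) / sqrt ((r ^ 4 - k\<^sup>2 * y ^ 4) / (r\<^sup>2)\<^sup>2) = 2 * k * y * r / sqrt (r ^ 4 - k\<^sup>2 * y ^ 4)"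
    using r by (simp add: real_sqrt_divide power2_eq_square)
  finally have sd: "shear_density k (x / r) = 2 * k * y * r / sqrt (r ^ 4 - k\<^sup>2 * y ^ 4)" .
  have "shear_density k (x / r) * ((Re v * r - x * ((x * Re v + y * Im v) / r)) / r\<^sup>2) = twist k z * Im (v / z)" for v
  proof -
    have "(Re v * r - x * ((x * Re v + y * Im v) / r)) / r\<^sup>2 = - (y / r) * Im (v / z)"
    proof -
      have "(Re v * r - x * ((x * Re v + y * Im v) / r)) = (Re v * r\<^sup>2 - x * (x * Re v + y * Im v)) / r"
        using r by (simp add: field_simps power2_eq_square)
      also have "Re v * r\<^sup>2 - x * (x * Re v + y * Im v) = - y * (Im v * x - Re v * y)"
        unfolding r2 by algebra
      finally show ?thesis
        unfolding Im_divide_complex by (simp add: r_def x_def y_def)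
    qed
    then show ?thesis
      unfolding sd twist_def using r by (simp add: r_def y_def power2_eq_square)
  qed
  then show ?thesis using D2 by simp
qed

text \<open>This is the minimality equation for \<tau>, with \<open>Re z / Im z\<close> as
  \<open>cot \<theta>\<close>: the twist depends on the angle alone, so its differential is a
  multiple of \<open>Im (v / z)\<close>.\<close>

lemma twist_has_derivative:
  assumes k: "\<bar>k\<bar> < 1" and z: "z \<in> H2"
  shows "(twist k has_derivative
     (\<lambda>v. Re z / Im z * twist k z * (4 + (twist k z)\<^sup>2) / 2 * Im (v / z))) (at z)"
proof -
  define x where "x = Re z"
  define y where "y = Im z"
  define R where "R = (norm z)\<^sup>2"
  define Q where "Q = R\<^sup>2 - k\<^sup>2 * y ^ 4"
  define s where "s = sqrt Q"
  have z0: "z \<noteq> 0" and y: "y > 0" using z by (auto simp: H2_def y_def)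
  have R: "R = x\<^sup>2 + y\<^sup>2" "R > 0" using z0 by (auto simp: R_def x_def y_def cmod_power2 simp flip: cmod_power2)
  have Q: "Q > 0" using twist_denom_pos[OF k z0] by (simp add: Q_def R_def y_def)
  then have s: "s > 0" "s\<^sup>2 = Q" by (auto simp: s_def)
  have tw: "twist k = (\<lambda>z. - 2 * k * (Im z)\<^sup>2 / sqrt (((Re z)\<^sup>2 + (Im z)\<^sup>2)\<^sup>2 - k\<^sup>2 * (Im z) ^ 4))"
    unfolding twist_def cmod_power2[symmetric] by (simp add: fun_eq_iff)
  have tz: "twist k z = - 2 * k * y\<^sup>2 / s"
    by (simp add: twist_def s_def Q_def R_def y_def)
  let ?Q' = "\<lambda>v. 2 * R * (2 * x * Re v + 2 * y * Im v) - k\<^sup>2 * (4 * y ^ 3 * Im v)"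
  have dQ: "((\<lambda>z. ((Re z)\<^sup>2 + (Im z)\<^sup>2)\<^sup>2 - k\<^sup>2 * (Im z) ^ 4) has_derivative ?Q') (at z)"
    by (auto intro!: derivative_eq_intros simp: R(1) x_def y_def algebra_simps fun_eq_iff)
  have Qz: "((Re z)\<^sup>2 + (Im z)\<^sup>2)\<^sup>2 - k\<^sup>2 * (Im z) ^ 4 = Q"
    by (simp add: Q_def R(1) x_def y_def)
  have ds: "((\<lambda>z. sqrt (((Re z)\<^sup>2 + (Im z)\<^sup>2)\<^sup>2 - k\<^sup>2 * (Im z) ^ 4)) has_derivative (\<lambda>v. ?Q' v / (2 * s))) (at z)"
    using has_derivative_real_sqrt[OF _ dQ] Qz Q by (simp add: s_def field_simps)
  have "(twist k has_derivative
      (\<lambda>v. (- 2 * k * (2 * y * Im v) * s - (- 2 * k * y\<^sup>2) * (?Q' v / (2 * s))) / (s * s))) (at z)"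
  proof -
    have "((\<lambda>z. - 2 * k * (Im z)\<^sup>2) has_derivative (\<lambda>v. - 2 * k * (2 * y * Im v))) (at z)"
      by (auto intro!: derivative_eq_intros simp: y_def)
    from has_derivative_divide'[OF this ds] show ?thesis
      unfolding tw y_def[symmetric] Qz[folded y_def] s_def[symmetric] using s by simp
  qed
  moreover have "(- 2 * k * (2 * y * Im v) * s - (- 2 * k * y\<^sup>2) * (?Q' v / (2 * s))) / (s * s)
      = Re z / Im z * twist k z * (4 + (twist k z)\<^sup>2) / 2 * Im (v / z)" for v
  proof -
    have "(- 2 * k * (2 * y * b) * s - (- 2 * k * y\<^sup>2) * (q / (2 * s))) / (s * s)
        = (- 4 * k * y * b * s\<^sup>2 + k * y\<^sup>2 * q) / s ^ 3" for b q
      using s(1) by (simp add: divide_simps) (simp add: power2_eq_square power3_eq_cube algebra_simps)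
    then have "(- 2 * k * (2 * y * Im v) * s - (- 2 * k * y\<^sup>2) * (?Q' v / (2 * s))) / (s * s)
        = (- 4 * k * y * Im v * s\<^sup>2 + k * y\<^sup>2 * ?Q' v) / s ^ 3" .
    also have "- 4 * k * y * Im v * s\<^sup>2 + k * y\<^sup>2 * ?Q' v = - 4 * k * y * x * R * (Im v * x - Re v * y)"
      unfolding s Q_def R(1) by algebra
    finally have 1: "(- 2 * k * (2 * y * Im v) * s - (- 2 * k * y\<^sup>2) * (?Q' v / (2 * s))) / (s * s)
        = - 4 * k * y * x * R * (Im v * x - Re v * y) / s ^ 3" .
    \<comment> \<open>The remaining factor \<open>R\<close> over \<open>s\<close> is eliminated in
      favour of the twist, which puts the explicit derivative into the form of the differential
      equation.\<close>
    have "4 + (twist k z)\<^sup>2 = (4 * s\<^sup>2 + 4 * k\<^sup>2 * y ^ 4) / s\<^sup>2"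
      unfolding tz using s(1) by (simp add: field_simps)
    also have "4 * s\<^sup>2 + 4 * k\<^sup>2 * y ^ 4 = 4 * R\<^sup>2"
      unfolding s Q_def by simp
    finally have 2: "4 + (twist k z)\<^sup>2 = 4 * R\<^sup>2 / s\<^sup>2" .
    have 3: "- 4 * k * y * x * R * A / s ^ 3 = x / y * (- 2 * k * y\<^sup>2 / s) * (4 * R\<^sup>2 / s\<^sup>2) / 2 * (A / R)" for A
      using s(1) R(2) y by (simp add: field_simps power2_eq_square power3_eq_cube)
    show ?thesis
      unfolding 1 3 tz 2[unfolded tz] Im_divide_complex x_def[symmetric] y_def[symmetric] R_def[symmetric] ..
  qed
  ultimately show ?thesis by simp
qed

section \<open>Smoothness\<close>

lemma open_H2: "open H2"
  unfolding H2_def by (intro open_Collect_less continuous_intros)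

lemma H2_nonzero: "z \<in> H2 \<Longrightarrow> z \<noteq> 0"
  by (auto simp: H2_def)

text \<open>An algebra of functions that contains the real and imaginary parts of \<open>shear_map k\<close> and is
  closed under directional derivatives on \<open>H2\<close>.\<close>

inductive shear_algebra :: "real \<Rightarrow> (complex \<Rightarrow> real) \<Rightarrow> bool" for k where
  const: "shear_algebra k (\<lambda>z. c)"
| Re: "shear_algebra k Re"
| Im: "shear_algebra k Im"
| inverse_norm: "shear_algebra k (\<lambda>z. 1 / (norm z)\<^sup>2)"
| inverse_sqrt: "shear_algebra k (\<lambda>z. 1 / sqrt ((norm z) ^ 4 - k\<^sup>2 * (Im z) ^ 4))"
| exp_shear: "shear_algebra k (\<lambda>z. exp (shear k (Re z / norm z)))"
| add: "shear_algebra k f \<Longrightarrow> shear_algebra k g \<Longrightarrow> shear_algebra k (\<lambda>z. f z + g z)"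
| mult: "shear_algebra k f \<Longrightarrow> shear_algebra k g \<Longrightarrow> shear_algebra k (\<lambda>z. f z * g z)"

lemma shear_algebra_minus: "shear_algebra k f \<Longrightarrow> shear_algebra k (\<lambda>z. - f z)"
  using shear_algebra.mult[OF shear_algebra.const[of k "-1"]] by simp

lemma shear_algebra_diff:
  "shear_algebra k f \<Longrightarrow> shear_algebra k g \<Longrightarrow> shear_algebra k (\<lambda>z. f z - g z)"
  using shear_algebra.add[OF _ shear_algebra_minus] by simp

lemma shear_algebra_power: "shear_algebra k f \<Longrightarrow> shear_algebra k (\<lambda>z. f z ^ n)"
  by (induction n) (auto intro: shear_algebra.intros)

lemmas shear_algebra_intros =
  shear_algebra.intros shear_algebra_minus shear_algebra_diff shear_algebra_power

text \<open>The generators are chosen so that each derivative is a polynomial in them: an inverse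
  square root yields its own cube, and the exponential yields itself times the twist times
  \<open>Im (v / z)\<close>, both of which lie in the algebra. Sums and products follow by the
  Leibniz rule.\<close>

lemma shear_algebra_has_derivative:
  assumes k: "\<bar>k\<bar> < 1" and "shear_algebra k f"
  shows "\<exists>f'. (\<forall>z\<in>H2. (f has_derivative f' z) (at z)) \<and> (\<forall>v. shear_algebra k (\<lambda>z. f' z v))"
proof -
  have closed: "\<exists>f'. (\<forall>z\<in>H2. (f has_derivative f' z) (at z)) \<and> (\<forall>v. shear_algebra k (\<lambda>z. f' z v))"
    if "\<And>z. z \<in> H2 \<Longrightarrow> (f has_derivative f' z) (at z)" "\<And>v. shear_algebra k (\<lambda>z. f' z v)" for f f'
    using that by blast
  from assms(2) show ?thesis
  proof induction
    case (const c)
    show ?case by (rule exI[of _ "\<lambda>z v. 0"]) (auto intro: shear_algebra_intros)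
  next
    case Re
    show ?case
      by (rule exI[of _ "\<lambda>z v. Re v"]) (auto intro: shear_algebra_intros has_derivative_Re[OF has_derivative_ident])
  next
    case Im
    show ?case
      by (rule exI[of _ "\<lambda>z v. Im v"]) (auto intro: shear_algebra_intros has_derivative_Im[OF has_derivative_ident])
  next
    case inverse_norm
    have "((\<lambda>z. 1 / (norm z)\<^sup>2) has_derivative
        (\<lambda>v. - (1 / (norm z)\<^sup>2)\<^sup>2 * (2 * Re z * Re v + 2 * Im z * Im v))) (at z)" if "z \<in> H2" for z
    proof -
      have "((\<lambda>z. (Re z)\<^sup>2 + (Im z)\<^sup>2) has_derivative (\<lambda>v. 2 * Re z * Re v + 2 * Im z * Im v)) (at z)"
        by (auto intro!: derivative_eq_intros)
      then have "((\<lambda>z. (norm z)\<^sup>2) has_derivative (\<lambda>v. 2 * Re z * Re v + 2 * Im z * Im v)) (at z)"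
        by (simp only: cmod_power2)
      from has_derivative_divide'[OF has_derivative_const[of 1] this] show ?thesis
        using H2_nonzero[OF that] by (simp add: power2_eq_square del: minus_add_distrib)
    qed
    then show ?case
      by (intro exI[of _ "\<lambda>z v. - (1 / (norm z)\<^sup>2)\<^sup>2 * (2 * Re z * Re v + 2 * Im z * Im v)"] conjI ballI allI)
         (auto intro!: shear_algebra_intros)
  next
    case inverse_sqrt
    define s where "s z = sqrt ((norm z) ^ 4 - k\<^sup>2 * (Im z) ^ 4)" for z
    let ?Q' = "\<lambda>z v. 2 * ((Re z)\<^sup>2 + (Im z)\<^sup>2) * (2 * Re z * Re v + 2 * Im z * Im v) - k\<^sup>2 * (4 * (Im z) ^ 3 * Im v)"
    have "((\<lambda>z. 1 / s z) has_derivative (\<lambda>v. - ((1 / s z) ^ 3) * (?Q' z v / 2))) (at z)" if z: "z \<in> H2" for z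
    proof -
      have Q: "0 < (norm z) ^ 4 - k\<^sup>2 * (Im z) ^ 4" using twist_denom_pos[OF k H2_nonzero[OF z]] .
      have 4: "(norm z) ^ 4 = ((Re z)\<^sup>2 + (Im z)\<^sup>2)\<^sup>2" for z by (simp add: cmod_power2[symmetric])
      have "((\<lambda>z. ((Re z)\<^sup>2 + (Im z)\<^sup>2)\<^sup>2 - k\<^sup>2 * (Im z) ^ 4) has_derivative ?Q' z) (at z)"
        by (auto intro!: derivative_eq_intros simp: algebra_simps fun_eq_iff)
      then have "((\<lambda>z. (norm z) ^ 4 - k\<^sup>2 * (Im z) ^ 4) has_derivative ?Q' z) (at z)"
        by (simp only: 4)
      from has_derivative_real_sqrt[OF Q this]
      have "(s has_derivative (\<lambda>v. ?Q' z v / (2 * s z))) (at z)"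
        by (simp add: s_def[abs_def] field_simps)
      moreover have "s z > 0" using Q by (simp add: s_def)
      ultimately show ?thesis
        using has_derivative_divide'[OF has_derivative_const[of 1], of s "\<lambda>v. ?Q' z v / (2 * s z)" z UNIV]
        by (simp add: power3_eq_cube mult_ac)
    qed
    moreover have "shear_algebra k (\<lambda>z. - ((1 / s z) ^ 3) * (?Q' z v / 2))" for v
    proof -
      have "shear_algebra k (\<lambda>z. 1 / s z)" unfolding s_def by (rule shear_algebra.inverse_sqrt)
      then have "shear_algebra k (\<lambda>z. - ((1 / s z) ^ 3) * (?Q' z v * (1 / 2)))" by (intro shear_algebra_intros)
      then show ?thesis by simp
    qed
    ultimately show ?case unfolding s_def by (rule closed)
  next
    case exp_shear
    let ?E = "\<lambda>z. exp (shear k (Re z / norm z))"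
    have "(?E has_derivative (\<lambda>v. ?E z * (twist k z * Im (v / z)))) (at z)" if z: "z \<in> H2" for z
      using has_derivative_exp[OF shear_angle_has_derivative[OF k z]] by (simp add: mult_ac)
    moreover have "shear_algebra k (\<lambda>z. ?E z * (twist k z * Im (v / z)))" for v
    proof -
      have "shear_algebra k (\<lambda>z. ?E z * (((- 2 * k) * (Im z)\<^sup>2 * (1 / sqrt ((norm z) ^ 4 - k\<^sup>2 * (Im z) ^ 4)))
          * ((Im v * Re z - Re v * Im z) * (1 / (norm z)\<^sup>2))))"
        by (intro shear_algebra_intros)
      then show ?thesis by (simp add: twist_def Im_divide_complex)
    qed
    ultimately show ?case by (rule closed)
  next
    case (add f g)
    then obtain f' g' where
      "\<And>z. z \<in> H2 \<Longrightarrow> (f has_derivative f' z) (at z)" "\<And>v. shear_algebra k (\<lambda>z. f' z v)"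
      "\<And>z. z \<in> H2 \<Longrightarrow> (g has_derivative g' z) (at z)" "\<And>v. shear_algebra k (\<lambda>z. g' z v)"
      by blast
    then show ?case
      by (intro exI[of _ "\<lambda>z v. f' z v + g' z v"]) (auto intro: shear_algebra_intros has_derivative_add)
  next
    case (mult f g)
    then obtain f' g' where
      "\<And>z. z \<in> H2 \<Longrightarrow> (f has_derivative f' z) (at z)" "\<And>v. shear_algebra k (\<lambda>z. f' z v)"
      "\<And>z. z \<in> H2 \<Longrightarrow> (g has_derivative g' z) (at z)" "\<And>v. shear_algebra k (\<lambda>z. g' z v)"
      by blast
    with mult.hyps show ?case
      by (intro exI[of _ "\<lambda>z v. f z * g' z v + f' z v * g z"]) (auto intro!: shear_algebra_intros has_derivative_mult)
  qed
qed

lemma smooth_on_shear_map: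
  assumes k: "\<bar>k\<bar> < 1" shows "smooth_on_open (shear_map k) H2"
proof (rule smooth_on_open_coinduct[OF open_H2])
  let ?P = "\<lambda>F. \<exists>g h. shear_algebra k g \<and> shear_algebra k h \<and> F = (\<lambda>z. of_real (g z) + \<i> * of_real (h z))"
  let ?E = "\<lambda>z. exp (shear k (Re z / norm z))"
  have "shear_algebra k (\<lambda>z. Re z * ?E z)" "shear_algebra k (\<lambda>z. Im z * ?E z)"
    by (intro shear_algebra_intros)+
  moreover have "shear_map k = (\<lambda>z. of_real (Re z * ?E z) + \<i> * of_real (Im z * ?E z))"
    by (auto simp: complex_eq_iff)
  ultimately show "?P (shear_map k)" by blast
  fix F assume "?P F"
  then obtain g h where g: "shear_algebra k g" and h: "shear_algebra k h"
    and F: "F = (\<lambda>z. of_real (g z) + \<i> * of_real (h z))" by blast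
  obtain g' where g': "\<And>z. z \<in> H2 \<Longrightarrow> (g has_derivative g' z) (at z)" "\<And>v. shear_algebra k (\<lambda>z. g' z v)"
    using shear_algebra_has_derivative[OF k g] by blast
  obtain h' where h': "\<And>z. z \<in> H2 \<Longrightarrow> (h has_derivative h' z) (at z)" "\<And>v. shear_algebra k (\<lambda>z. h' z v)"
    using shear_algebra_has_derivative[OF k h] by blast
  have "(F has_derivative (\<lambda>v. of_real (g' z v) + \<i> * of_real (h' z v))) (at z)" if "z \<in> H2" for z
    unfolding F using g'(1)[OF that] h'(1)[OF that]
    by (intro has_derivative_add has_derivative_mult_right has_derivative_of_real)
  moreover have "?P (\<lambda>z. of_real (g' z v) + \<i> * of_real (h' z v))" for v
    using g'(2) h'(2) by blast
  ultimately show "\<exists>f'. (\<forall>x\<in>H2. (F has_derivative f' x) (at x)) \<and> (\<forall>v. ?P (\<lambda>x. f' x v))"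
    by (intro exI[of _ "\<lambda>z v. of_real (g' z v) + \<i> * of_real (h' z v)"]) blast
qed

lemma diffeomorphism_shear_map:
  assumes "\<bar>k\<bar> < 1" shows "diffeomorphism_H2 (shear_map k)"
  unfolding diffeomorphism_H2_def
proof (intro conjI)
  have "smooth_on_open (shear_map (- k)) H2" using assms by (intro smooth_on_shear_map) simp
  then show "smooth_on_open (inv_into H2 (shear_map k)) H2"
    by (rule smooth_on_open_cong[rotated]) (simp add: inv_into_shear_map[OF assms])
qed (fact bij_betw_shear_map[OF assms] smooth_on_shear_map[OF assms])+

section \<open>Explicit first and second derivatives; preservation of area\<close>

text \<open>The logarithmic derivative of the map: in the coordinate \<open>log z\<close> it adds a
  real function of \<theta> with derivative \<tau>, which contributes
  \<open>twist k z * Im (v / z)\<close>.\<close>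

definition shear_deriv :: "real \<Rightarrow> complex \<Rightarrow> complex \<Rightarrow> complex" where
  "shear_deriv k z v = shear_map k z * (v / z + of_real (twist k z * Im (v / z)))"

lemma shear_map_has_derivative:
  assumes k: "\<bar>k\<bar> < 1" and z: "z \<in> H2"
  shows "(shear_map k has_derivative shear_deriv k z) (at z)"
proof -
  let ?E = "\<lambda>z. exp (shear k (Re z / norm z))"
  have "((\<lambda>z. z * complex_of_real (?E z)) has_derivative
      (\<lambda>v. z * of_real (?E z * (twist k z * Im (v / z))) + v * of_real (?E z))) (at z)"
    by (intro has_derivative_mult has_derivative_ident has_derivative_of_real)
       (use has_derivative_exp[OF shear_angle_has_derivative[OF k z]] in \<open>simp add: mult_ac\<close>)
  moreover have "z * of_real (?E z * (twist k z * Im (v / z))) + v * of_real (?E z) = shear_deriv k z v" for v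
    using H2_nonzero[OF z] by (simp add: shear_deriv_def shear_map_def distrib_left)
  ultimately show ?thesis by (simp add: shear_map_def[abs_def])
qed

lemma diff_at_shear_map: "\<bar>k\<bar> < 1 \<Longrightarrow> z \<in> H2 \<Longrightarrow> diff_at (shear_map k) z = shear_deriv k z"
  using frechet_derivative_at[OF shear_map_has_derivative] by simp

text \<open>Write the first derivative as the map times a one-form. The product rule gives the
  product of this form at \<open>v\<close> and \<open>w\<close>, plus the derivative of the form:
  the terms in \<open>v * w / z\<^sup>2\<close> come from differentiating \<open>w / z\<close>, the
  remaining one from the equation for the twist.\<close>

lemma shear_deriv_has_derivative:
  assumes k: "\<bar>k\<bar> < 1" and z: "z \<in> H2"
  shows "((\<lambda>z. shear_deriv k z w) has_derivative
     (\<lambda>v. shear_map k z *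
       ((v / z + of_real (twist k z * Im (v / z))) * (w / z + of_real (twist k z * Im (w / z)))
         - v * w / z\<^sup>2
         + of_real (Re z / Im z * twist k z * (4 + (twist k z)\<^sup>2) / 2 * Im (v / z) * Im (w / z)
             - twist k z * Im (v * w / z\<^sup>2))))) (at z)"
proof -
  have "((\<lambda>z. w / z) has_derivative (\<lambda>v. - (v * w / z\<^sup>2))) (at z)"
    using H2_nonzero[OF z]
    by (auto intro!: derivative_eq_intros simp: power2_eq_square field_simps fun_eq_iff)
  then have "((\<lambda>z. shear_map k z * (w / z + of_real (twist k z * Im (w / z)))) has_derivative
     (\<lambda>v. shear_map k z * (- (v * w / z\<^sup>2) + of_real (twist k z * Im (- (v * w / z\<^sup>2))
          + Re z / Im z * twist k z * (4 + (twist k z)\<^sup>2) / 2 * Im (v / z) * Im (w / z)))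
        + shear_deriv k z v * (w / z + of_real (twist k z * Im (w / z))))) (at z)"
    by (intro has_derivative_mult shear_map_has_derivative[OF k z] has_derivative_add
        has_derivative_of_real twist_has_derivative[OF k z] has_derivative_Im)
  moreover have "shear_map k z * (- (v * w / z\<^sup>2) + of_real (twist k z * Im (- (v * w / z\<^sup>2))
          + Re z / Im z * twist k z * (4 + (twist k z)\<^sup>2) / 2 * Im (v / z) * Im (w / z)))
        + shear_deriv k z v * (w / z + of_real (twist k z * Im (w / z)))
      = shear_map k z *
       ((v / z + of_real (twist k z * Im (v / z))) * (w / z + of_real (twist k z * Im (w / z)))
         - v * w / z\<^sup>2
         + of_real (Re z / Im z * twist k z * (4 + (twist k z)\<^sup>2) / 2 * Im (v / z) * Im (w / z)
             - twist k z * Im (v * w / z\<^sup>2)))" for v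
    unfolding shear_deriv_def uminus_complex.sel mult_minus_right of_real_add of_real_diff of_real_minus
    by algebra
  ultimately show ?thesis unfolding shear_deriv_def by simp
qed

text \<open>In the coordinate \<open>log z\<close> the differential is the shear that adds
  \<open>t * Im a\<close> to \<open>a\<close>, of determinant 1. Passing to the image point
  multiplies both \<open>(norm z)\<^sup>2\<close> and \<open>(Im z)\<^sup>2\<close> by the square of
  \<open>E\<close>, which cancels in the hyperbolic area.\<close>

lemma shear_map_area_preserving:
  assumes k: "\<bar>k\<bar> < 1" shows "area_preserving_H2 (shear_map k)"
  unfolding area_preserving_H2_def
proof (intro ballI allI)
  fix z v w assume z: "z \<in> H2"
  define E where "E = exp (shear k (Re z / norm z))"
  define t where "t = twist k z"
  define a where "a = v / z"
  define b where "b = w / z"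
  have vw: "v = z * a" "w = z * b" using H2_nonzero[OF z] by (simp_all add: a_def b_def)
  have f: "shear_map k z = of_real E * z" by (simp add: shear_map_def E_def)
  have E: "E > 0" by (simp add: E_def)
  have scale: "Im (cnj (u * c) * (u * d)) = (norm u)\<^sup>2 * Im (cnj c * d)" for u c d :: complex
  proof -
    have "cnj (u * c) * (u * d) = of_real ((norm u)\<^sup>2) * (cnj c * d)"
      unfolding complex_norm_square by (simp add: mult_ac)
    then show ?thesis by (metis Im_complex_of_real Re_complex_of_real add_0_right mult_zero_left times_complex.simps(2))
  qed
  have "Im (cnj (shear_deriv k z v) * shear_deriv k z w)
      = (norm (shear_map k z))\<^sup>2 * Im (cnj (a + of_real (t * Im a)) * (b + of_real (t * Im b)))"
    unfolding shear_deriv_def a_def[symmetric] b_def[symmetric] t_def[symmetric] by (rule scale)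
  also have "Im (cnj (a + of_real (t * Im a)) * (b + of_real (t * Im b))) = Im (cnj a * b)"
    by (simp add: algebra_simps)
  also have "(norm (shear_map k z))\<^sup>2 * Im (cnj a * b) = E\<^sup>2 * Im (cnj v * w)"
    unfolding vw scale f using E by (simp add: norm_mult power_mult_distrib)
  finally show "hyp_area_form (shear_map k z) (diff_at (shear_map k) z v) (diff_at (shear_map k) z w)
      = hyp_area_form z v w"
    unfolding diff_at_shear_map[OF k z] hyp_area_form_def
    using E by (simp add: f power_mult_distrib)
qed

lemma shear_map_orientation_preserving:
  assumes k: "\<bar>k\<bar> < 1" shows "orientation_preserving_H2 (shear_map k)"
  using shear_map_area_preserving[OF k]
  by (auto simp: orientation_preserving_H2_def area_preserving_H2_def hyp_area_form_def H2_def)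

section \<open>Minimality of the graph\<close>

lemma inner_mult_complex: "inner (z * u) w = inner u (cnj z * w)" for z u w :: complex
  by (simp add: inner_complex_def algebra_simps)

lemma graph_shear_map_has_derivative:
  assumes "\<bar>k\<bar> < 1" "z \<in> H2"
  shows "(graph_map (shear_map k) has_derivative (\<lambda>v. (v, shear_deriv k z v))) (at z)"
  unfolding graph_map_def[abs_def]
  by (intro has_derivative_Pair has_derivative_ident shear_map_has_derivative assms)

lemma diff_at_graph_shear_map:
  "\<bar>k\<bar> < 1 \<Longrightarrow> z \<in> H2 \<Longrightarrow> diff_at (graph_map (shear_map k)) z = (\<lambda>v. (v, shear_deriv k z v))"
  using frechet_derivative_at[OF graph_shear_map_has_derivative] by simp

text \<open>Tangent vectors at \<open>z\<close> are written \<open>z * u\<close>, so that \<open>u\<close> is the vector in the coordinate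
  \<open>log z\<close>. The term \<open>- u\<^sup>2\<close> common to both components, together with \<open>- 2 * t * Re u * b\<close>, is
  tangent to the graph and drops out of the second fundamental form.\<close>

lemma cov_second_deriv_graph_shear_map:
  fixes k :: real and z u :: complex
  assumes k: "\<bar>k\<bar> < 1" and z: "z \<in> H2"
  defines "c \<equiv> Re z / Im z" and "t \<equiv> twist k z" and "b \<equiv> Im u"
  shows "cov_second_deriv (graph_map (shear_map k)) z (z * u) (z * u) =
    (z * (\<i> * of_real c * u\<^sup>2 - u\<^sup>2),
     shear_map k z * (\<i> * of_real c * (u + of_real (t * b))\<^sup>2 - u\<^sup>2
       + of_real (c * t * (4 + t\<^sup>2) / 2 * b\<^sup>2 - 2 * t * Re u * b)))"
proof -
  have z0: "z \<noteq> 0" "Im z > 0" using z by (auto simp: H2_def)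
  let ?w = "z * u"
  define E where "E = exp (shear k (Re z / norm z))"
  have E: "E > 0" by (simp add: E_def)
  have f: "shear_map k z = z * of_real E" by (simp add: shear_map_def E_def)
  have Ef: "Im (shear_map k z) = Im z * E" by (simp add: E_def)
  \<comment> \<open>The Christoffel multiplier relative to \<open>log z\<close> is a function of the
    angle. The map preserves angles, so the same multiplier appears at the image point in
    \<open>G2\<close>.\<close>
  have iz: "\<i> * z / of_real (Im z) = \<i> * of_real c - 1"
    using z0 by (simp add: c_def complex_eq_iff)
  have df: "shear_deriv k z ?w = shear_map k z * (u + of_real (t * b))"
    using z0 by (simp add: shear_deriv_def t_def b_def)
  have "((\<lambda>x. (?w, shear_deriv k x ?w)) has_derivative
      (\<lambda>v. (0, shear_map k z *
       ((v / z + of_real (twist k z * Im (v / z))) * (?w / z + of_real (twist k z * Im (?w / z)))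
         - v * ?w / z\<^sup>2
         + of_real (Re z / Im z * twist k z * (4 + (twist k z)\<^sup>2) / 2 * Im (v / z) * Im (?w / z)
             - twist k z * Im (v * ?w / z\<^sup>2)))))) (at z)"
    by (intro has_derivative_Pair has_derivative_const shear_deriv_has_derivative[OF k z])
  then have "((\<lambda>x. diff_at (graph_map (shear_map k)) x ?w) has_derivative
      (\<lambda>v. (0, shear_map k z *
       ((v / z + of_real (twist k z * Im (v / z))) * (?w / z + of_real (twist k z * Im (?w / z)))
         - v * ?w / z\<^sup>2
         + of_real (Re z / Im z * twist k z * (4 + (twist k z)\<^sup>2) / 2 * Im (v / z) * Im (?w / z)
             - twist k z * Im (v * ?w / z\<^sup>2)))))) (at z)"
    by (rule has_derivative_transform_within_open[OF _ open_H2 z]) (simp add: diff_at_graph_shear_map[OF k])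
  from frechet_derivative_at[OF this, symmetric]
  have d2: "diff_at (\<lambda>x. diff_at (graph_map (shear_map k)) x ?w) z ?w =
      (0, shear_map k z * ((u + of_real (t * b)) * (u + of_real (t * b)) - u\<^sup>2
         + of_real (c * t * (4 + t\<^sup>2) / 2 * b * b - t * Im (u\<^sup>2))))"
  proof -
    have "?w * ?w / z\<^sup>2 = u\<^sup>2" "?w / z = u" using z0 by (simp_all add: power2_eq_square)
    with \<open>diff_at (\<lambda>x. diff_at (graph_map (shear_map k)) x ?w) z = _\<close> show ?thesis
      unfolding c_def t_def b_def by simp
  qed
  have G1: "hyp_christoffel z ?w ?w = z * ((\<i> * of_real c - 1) * u\<^sup>2)"
    unfolding hyp_christoffel_def iz[symmetric] by (simp add: power2_eq_square mult_ac)
  have G2: "hyp_christoffel (shear_map k z) (shear_deriv k z ?w) (shear_deriv k z ?w)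
      = shear_map k z * ((\<i> * of_real c - 1) * (u + of_real (t * b))\<^sup>2)"
    unfolding hyp_christoffel_def df Ef iz[symmetric] power2_eq_square of_real_mult[of "Im z"]
    unfolding f using E by (simp add: mult_ac)
  have "Im (u\<^sup>2) = 2 * Re u * b" by (simp add: b_def power2_eq_square)
  then show ?thesis
    unfolding cov_second_deriv_def d2 prod_christoffel_def diff_at_graph_shear_map[OF k z]
      graph_map_def fst_conv snd_conv G1 G2
    by (simp add: b_def[symmetric] algebra_simps power2_eq_square)
qed

text \<open>A normal vector is determined by its second component, encoded by \<open>P\<close> in
  the coordinate \<open>log z\<close> with the metric weight absorbed. In these terms the form is
  quadratic in \<open>u\<close> and every coefficient carries the factor
  \<open>c * t\<close>.\<close>

lemma second_fundamental_form_graph_shear_map: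
  fixes k :: real and z u N1 N2 :: complex
  assumes k: "\<bar>k\<bar> < 1" and z: "z \<in> H2"
    and N: "normal_vector (graph_map (shear_map k)) z (N1, N2)"
  defines "c \<equiv> Re z / Im z" and "t \<equiv> twist k z"
    and "P \<equiv> cnj (shear_map k z) * N2 / of_real ((Im (shear_map k z))\<^sup>2)"
  shows "second_fundamental_form (graph_map (shear_map k)) z (N1, N2) (z * u) (z * u) =
     - c * t * Re P * (Re u)\<^sup>2 + 2 * c * t * Im P * Re u * Im u
     + ((c * t * (4 + t\<^sup>2) / 2 - c * t) * Re P + c * t\<^sup>2 * Im P) * (Im u)\<^sup>2"
proof -
  define P1 where "P1 = cnj z * N1 / of_real ((Im z)\<^sup>2)"
  have z0: "z \<noteq> 0" using z by (auto simp: H2_def)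
  have metric: "prod_metric (graph_map (shear_map k) z) (z * v, shear_map k z * w) (N1, N2)
      = inner v P1 + inner w P" for v w
    unfolding prod_metric_def hyp_metric_def graph_map_def fst_conv snd_conv inner_mult_complex P1_def P_def
    by (simp add: inner_complex_def add_divide_distrib distrib_left del: Im_shear_map Re_shear_map of_real_power)
  have "inner v P1 + inner (v + of_real (t * Im v)) P = 0" for v
  proof -
    have "prod_metric (graph_map (shear_map k) z) (z * v, shear_map k z * (v + of_real (t * Im v))) (N1, N2) = 0"
      using N z0 unfolding normal_vector_def diff_at_graph_shear_map[OF k z] t_def shear_deriv_def
      by (auto dest: spec[of _ "z * v"])
    then show ?thesis unfolding metric .
  qed
  \<comment> \<open>Orthogonality to the two basic tangent vectors solves for the first component of
    the normal.\<close>
  from this[of 1] this[of \<i>] have P1: "Re P1 = - Re P" "Im P1 = - Im P - t * Re P"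
    by (simp_all add: inner_complex_def)
  show ?thesis
    unfolding second_fundamental_form_def cov_second_deriv_graph_shear_map[OF k z] metric
      c_def[symmetric] t_def[symmetric]
    by (simp add: inner_complex_def P1 power2_eq_square) algebra
qed

text \<open>The trace over any orthonormal frame is the contraction of the second fundamental form
  with the inverse Gram matrix. In the coordinate \<open>log z\<close> the Gram matrix has entries
  \<open>2 * s\<close>, \<open>t * s\<close> and \<open>(2 + t\<^sup>2) * s\<close>, so
  \<open>orthonormal_frame_dual\<close> treats all frames at once.\<close>

lemma minimal_graph_shear_map:
  assumes k: "\<bar>k\<bar> < 1" shows "minimal_graph (shear_map k)"
  unfolding minimal_graph_def
proof (intro ballI allI impI)
  fix z N e1 e2
  assume z: "z \<in> H2"
    and "normal_vector (graph_map (shear_map k)) z N \<and> orthonormal_frame (graph_map (shear_map k)) z e1 e2"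
  then have N: "normal_vector (graph_map (shear_map k)) z (fst N, snd N)"
    and on: "orthonormal_frame (graph_map (shear_map k)) z e1 e2" by auto
  have z0: "z \<noteq> 0" "Im z > 0" using z by (auto simp: H2_def)
  define c where "c = Re z / Im z"
  define t where "t = twist k z"
  define P where "P = cnj (shear_map k z) * snd N / of_real ((Im (shear_map k z))\<^sup>2)"
  define s where "s = (norm z)\<^sup>2 / (Im z)\<^sup>2"
  have s: "s > 0" using z0 by (simp add: s_def)
  define u1 where "u1 = e1 / z"
  define u2 where "u2 = e2 / z"
  have e: "e1 = z * u1" "e2 = z * u2" using z0 by (simp_all add: u1_def u2_def)
  have inner_scale: "inner (z * v) (z * w) = (norm z)\<^sup>2 * inner v w" for z v w :: complex
    by (simp add: inner_complex_def cmod_power2) algebra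
  have metric: "prod_metric (graph_map (shear_map k) z) (diff_at (graph_map (shear_map k)) z (z * v))
      (diff_at (graph_map (shear_map k)) z (z * w)) =
      s * (inner v w + inner (v + of_real (t * Im v)) (w + of_real (t * Im w)))" for v w
  proof -
    have "(norm (shear_map k z))\<^sup>2 / (Im (shear_map k z))\<^sup>2 = s"
      by (simp add: shear_map_def norm_mult s_def power_mult_distrib)
    then show ?thesis
      using z0 unfolding diff_at_graph_shear_map[OF k z] prod_metric_def hyp_metric_def graph_map_def
        fst_conv snd_conv shear_deriv_def inner_scale
      by (simp add: t_def s_def distrib_left flip: times_divide_eq_left del: Im_shear_map)
  qed
  have q: "s * (inner v w + inner (v + of_real (t * Im v)) (w + of_real (t * Im w))) =
      2 * s * Re v * Re w + t * s * (Re v * Im w + Im v * Re w) + (2 + t\<^sup>2) * s * Im v * Im w" for v w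
    by (simp add: inner_complex_def power2_eq_square algebra_simps)
  have on': "2 * s * (Re u1)\<^sup>2 + 2 * (t * s) * Re u1 * Im u1 + (2 + t\<^sup>2) * s * (Im u1)\<^sup>2 = 1"
    "2 * s * (Re u2)\<^sup>2 + 2 * (t * s) * Re u2 * Im u2 + (2 + t\<^sup>2) * s * (Im u2)\<^sup>2 = 1"
    "2 * s * Re u1 * Re u2 + t * s * (Re u1 * Im u2 + Im u1 * Re u2) + (2 + t\<^sup>2) * s * Im u1 * Im u2 = 0"
    using on unfolding orthonormal_frame_def e metric q by (simp_all add: power2_eq_square algebra_simps)
  define A where "A = (Re u1)\<^sup>2 + (Re u2)\<^sup>2"
  define B where "B = Re u1 * Im u1 + Re u2 * Im u2"
  define C where "C = (Im u1)\<^sup>2 + (Im u2)\<^sup>2"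
  define D where "D = s\<^sup>2 * (4 + t\<^sup>2)"
  have D: "2 * s * ((2 + t\<^sup>2) * s) - (t * s)\<^sup>2 = D" by (simp add: D_def power2_eq_square algebra_simps)
  have ABC: "D * A = (2 + t\<^sup>2) * s" "D * B = - (t * s)" "D * C = 2 * s"
    using orthonormal_frame_dual[OF on'] unfolding D A_def B_def C_def by auto
  let ?II = "\<lambda>e. second_fundamental_form (graph_map (shear_map k)) z N e e"
  define K where "K = (c * t * (4 + t\<^sup>2) / 2 - c * t) * Re P + c * t\<^sup>2 * Im P"
  have II: "?II (z * u) = - c * t * Re P * (Re u)\<^sup>2 + 2 * c * t * Im P * Re u * Im u + K * (Im u)\<^sup>2" for u
    using second_fundamental_form_graph_shear_map[OF k z N, of u]
    unfolding prod.collapse K_def P_def c_def t_def .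
  have "D * (?II e1 + ?II e2) = - c * t * Re P * (D * A) + 2 * c * t * Im P * (D * B) + K * (D * C)"
    unfolding e II A_def B_def C_def by (simp add: algebra_simps)
  \<comment> \<open>The coefficient of \<open>Im P\<close> cancels for every twist; that of
    \<open>Re P\<close> cancels because of the term with \<open>4 + t\<^sup>2\<close>, supplied by
    the differential equation.\<close>
  also have "\<dots> = 0" unfolding ABC K_def by (simp add: field_simps power2_eq_square)
  finally have "D * (?II e1 + ?II e2) = 0" .
  moreover have "D > 0" using s by (simp add: D_def add_pos_nonneg)
  ultimately show "?II e1 + ?II e2 = 0" by simp
qed

lemma minimal_lagrangian_shear_map: "\<bar>k\<bar> < 1 \<Longrightarrow> minimal_lagrangian (shear_map k)"
  by (simp add: minimal_lagrangian_def diffeomorphism_shear_map shear_map_orientation_preserving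
      shear_map_area_preserving minimal_graph_shear_map)

section \<open>Boundary values and estimates\<close>

text \<open>The trace of \<open>shear_map k\<close> on the real axis, where the cosine of the angle
  is \<open>sgn x\<close>. At 0 the exponential factor is immaterial, as \<open>x\<close>
  vanishes.\<close>

definition boundary_shear :: "real \<Rightarrow> real \<Rightarrow> real" where
  "boundary_shear k x = x * exp (shear k (sgn x))"

lemma shear_map_of_real: "shear_map k (of_real x) = of_real (boundary_shear k x)"
  by (simp add: shear_map_def boundary_shear_def sgn_real_def)

lemma boundary_shear_inverse:
  assumes "\<bar>k\<bar> < 1" shows "boundary_shear (- k) (boundary_shear k x) = x"
  using shear_map_inverse[OF assms, of "of_real x"] by (simp add: shear_map_of_real)

lemma continuous_on_boundary_shear:
  assumes "\<bar>k\<bar> < 1" shows "continuous_on UNIV (boundary_shear k)"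
proof -
  have "boundary_shear k = (\<lambda>x. Re (shear_map k (of_real x)))"
    unfolding shear_map_of_real by simp
  moreover have "continuous_on UNIV (\<lambda>x. Re (shear_map k (of_real x)))"
    by (intro continuous_intros continuous_on_compose2[OF continuous_on_shear_map[OF assms]]) auto
  ultimately show ?thesis by simp
qed

lemma shear_mono:
  assumes "0 \<le> k" "k < 1" "a \<le> b" shows "shear k a \<le> shear k b"
proof (rule DERIV_nonneg_imp_nondecreasing[OF assms(3)])
  have k: "\<bar>k\<bar> < 1" using assms by simp
  show "\<exists>y. (shear k has_real_derivative y) (at x) \<and> 0 \<le> y" for x
    using shear_antiderivative(2)[OF k, of x] assms(1) shear_density_denom_pos[OF k, of x]
    by (intro exI[of _ "shear_density k x"]) (simp add: shear_density_def)
qed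

lemma boundary_shear_eq:
  assumes "\<bar>k\<bar> < 1"
  shows "boundary_shear k x = x * exp (if 0 \<le> x then shear k 1 else - shear k 1)"
  using shear_minus_right[OF assms, of 1] by (auto simp: boundary_shear_def sgn_real_def)

text \<open>A secant of a piecewise linear function has slope between the two slopes, here
  \<open>exp (- L)\<close> and \<open>exp L\<close>; an interval containing 0 is split there. This
  controls both monotonicity and cross-ratios.\<close>

lemma boundary_shear_slope:
  assumes k: "0 \<le> k" "k < 1"
  obtains r where "exp (- shear k 1) \<le> r" "r \<le> exp (shear k 1)"
    "boundary_shear k x - boundary_shear k y = r * (x - y)"
proof -
  have k': "\<bar>k\<bar> < 1" using k by simp
  define L where "L = shear k 1"
  have L: "0 \<le> L" using shear_mono[OF k, of 0 1] shear_antiderivative(1)[OF k'] by (simp add: L_def)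
  have b: "boundary_shear k x = x * exp (if 0 \<le> x then L else - L)" for x
    unfolding L_def by (rule boundary_shear_eq[OF k'])
  have eL: "exp (- L) \<le> exp L" using L by simp
  have *: "\<exists>r. exp (- L) \<le> r \<and> r \<le> exp L \<and> boundary_shear k x - boundary_shear k y = r * (x - y)"
    if "y < x" for x y
  proof -
    have "exp (- L) * (x - y) \<le> boundary_shear k x - boundary_shear k y"
      "boundary_shear k x - boundary_shear k y \<le> exp L * (x - y)"
      using that eL mult_left_mono[OF eL, of x] mult_left_mono[OF eL, of "- y"]
        mult_left_mono[OF eL, of "x - y"] unfolding b by (auto simp: algebra_simps)
    then show ?thesis
      using that by (intro exI[of _ "(boundary_shear k x - boundary_shear k y) / (x - y)"])
        (auto simp: pos_le_divide_eq pos_divide_le_eq)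
  qed
  have "\<exists>r. exp (- L) \<le> r \<and> r \<le> exp L \<and> boundary_shear k x - boundary_shear k y = r * (x - y)"
  proof (cases x y rule: linorder_cases)
    case less
    then obtain r where "exp (- L) \<le> r" "r \<le> exp L" "boundary_shear k y - boundary_shear k x = r * (y - x)"
      using * by blast
    then show ?thesis by (intro exI[of _ r]) (simp add: algebra_simps)
  next
    case equal
    then show ?thesis using eL by auto
  next
    case greater
    then show ?thesis using * by blast
  qed
  then show ?thesis using that unfolding L_def by blast
qed

lemma strict_mono_boundary_shear:
  assumes "0 \<le> k" "k < 1" shows "strict_mono (boundary_shear k)"
proof (rule strict_monoI)
  fix x y :: real assume "x < y"
  obtain r where r: "exp (- shear k 1) \<le> r" "boundary_shear k y - boundary_shear k x = r * (y - x)"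
    using boundary_shear_slope[OF assms] by metis
  have "0 < r" using r(1) exp_gt_zero order_less_le_trans by blast
  then show "boundary_shear k x < boundary_shear k y"
    using r(2) \<open>x < y\<close> by (metis diff_gt_0_iff_gt mult_pos_pos)
qed

text \<open>The map fixes infinity, where the circle is cut, and is increasing on the rest, so it
  preserves the linear order behind the cyclic one.\<close>

lemma orientation_preserving_boundary_shear:
  assumes "0 \<le> k" "k < 1"
  shows "orientation_preserving_homeo_RP1 (map_option (boundary_shear k))"
  unfolding orientation_preserving_homeo_RP1_def
proof (intro conjI allI impI)
  have k: "\<bar>k\<bar> < 1" "\<bar>- k\<bar> < 1" using assms by auto
  have inv: "boundary_shear (- k) (boundary_shear k x) = x" "boundary_shear k (boundary_shear (- k) x) = x" for x
    using boundary_shear_inverse[OF k(1)] boundary_shear_inverse[OF k(2)] by simp_all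
  have "homeomorphic_maps RP1 RP1 (map_option (boundary_shear k)) (map_option (boundary_shear (- k)))"
    unfolding homeomorphic_maps_def RP1_def
    using continuous_map_Alexandroff_map_option[OF continuous_on_boundary_shear[OF k(1)] continuous_on_boundary_shear[OF k(2)]]
      continuous_map_Alexandroff_map_option[OF continuous_on_boundary_shear[OF k(2)] continuous_on_boundary_shear[OF k(1)]]
    by (simp add: inv option.map_comp comp_def option.map_ident)
  then show "homeomorphic_map RP1 RP1 (map_option (boundary_shear k))"
    using homeomorphic_maps_map by blast
next
  fix p q r assume "cyclically_ordered p q r"
  moreover have "rp1_cut p < rp1_cut q \<longleftrightarrow>
      rp1_cut (map_option (boundary_shear k) p) < rp1_cut (map_option (boundary_shear k) q)" for p q
    using strict_mono_less[OF strict_mono_boundary_shear[OF assms]]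
    by (cases p; cases q) (auto simp: rp1_cut_def)
  ultimately show "cyclically_ordered (map_option (boundary_shear k) p)
      (map_option (boundary_shear k) q) (map_option (boundary_shear k) r)"
    unfolding cyclically_ordered_def by blast
qed

text \<open>On the closed half-plane the glued map is the restriction of the extension of
  \<open>shear_map k\<close> to the Riemann sphere, which is already continuous.\<close>

lemma shear_map_extends_continuously:
  assumes "\<bar>k\<bar> < 1"
  shows "extends_continuously (shear_map k) (map_option (boundary_shear k))"
proof -
  have "continuous_map (Alexandroff_compactification euclidean)
      (Alexandroff_compactification euclidean) (map_option (shear_map k))"
    using assms shear_map_inverse[OF assms] shear_map_inverse'[OF assms]
    by (intro continuous_map_Alexandroff_map_option[where h = "shear_map (- k)"] continuous_on_shear_map) auto
  then have "continuous_map closed_H2 closed_H2 (map_option (shear_map k))"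
    unfolding closed_H2_def continuous_map_in_subtopology
    by (auto simp: continuous_map_from_subtopology)
  moreover have "glue (shear_map k) (map_option (boundary_shear k)) p = map_option (shear_map k) p"
    if "p \<in> topspace closed_H2" for p
  proof (cases p)
    case None
    then show ?thesis by (simp add: glue_def)
  next
    case (Some z)
    have "z = of_real (Re z)" if "z \<notin> H2"
      using that \<open>p \<in> topspace closed_H2\<close> Some by (auto simp: closed_H2_def H2_def complex_eq_iff)
    then show ?thesis
      using Some by (simp add: glue_def) (metis shear_map_of_real)
  qed
  ultimately show ?thesis
    unfolding extends_continuously_def by (metis (no_types, lifting) continuous_map_eq)
qed

section \<open>Two-sided bound for the cross-ratio norm\<close>

text \<open>Each of the four differences in a cross-ratio is multiplied by a factor whose logarithm
  is at most \<open>L\<close> in absolute value, which gives the upper bound. One harmonic quadruple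
  gives the lower bound.\<close>

lemma cross_ratio_norm_boundary_shear:
  assumes k: "0 \<le> k" "k < 1"
  shows "ereal (2 * shear k 1) \<le> cross_ratio_norm (map_option (boundary_shear k))"
    and "cross_ratio_norm (map_option (boundary_shear k)) \<le> ereal (4 * shear k 1)"
proof -
  have k': "\<bar>k\<bar> < 1" using k by simp
  define L where "L = shear k 1"
  define p where "p = map_option (boundary_shear k)"
  have L: "0 \<le> L" using shear_mono[OF k, of 0 1] shear_antiderivative(1)[OF k'] by (simp add: L_def)
  have slope: "\<exists>r. exp (- L) \<le> r \<and> r \<le> exp L \<and> rp1_diff (p a) (p b) = r * rp1_diff a b" for a b
  proof (cases "a = None \<or> b = None")
    \<comment> \<open>Against infinity \<open>rp1_diff\<close> is constant on finite points and
      infinity is fixed, so the factor is 1.\<close>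
    case True
    then have "rp1_diff (p a) (p b) = 1 * rp1_diff a b" by (cases a; cases b) (auto simp: p_def)
    then show ?thesis using L by (intro exI[of _ 1]) auto
  next
    case False
    moreover have "\<exists>r. exp (- L) \<le> r \<and> r \<le> exp L \<and> boundary_shear k x - boundary_shear k y = r * (x - y)" for x y
      using boundary_shear_slope[OF k, of x y] unfolding L_def by blast
    ultimately show ?thesis by (auto simp: p_def)
  qed
  show "cross_ratio_norm p \<le> ereal (4 * shear k 1)"
    unfolding cross_ratio_norm_def
  proof (rule SUP_least, clarify)
    fix x1 x2 x3 x4 assume cr: "cross_ratio x1 x2 x3 x4 = -1"
    have ln: "\<bar>ln r\<bar> \<le> L \<and> 0 < r" if "exp (- L) \<le> r" "r \<le> exp L" for r
    proof -
      have "0 < r" using that(1) exp_gt_zero order_less_le_trans by blast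
      then show ?thesis using that by (metis abs_le_iff ln_exp ln_le_cancel_iff exp_gt_zero minus_le_iff)
    qed
    obtain r1 r2 r3 r4 where r: "\<bar>ln r1\<bar> \<le> L" "0 < r1" "\<bar>ln r2\<bar> \<le> L" "0 < r2"
        "\<bar>ln r3\<bar> \<le> L" "0 < r3" "\<bar>ln r4\<bar> \<le> L" "0 < r4"
      and d: "rp1_diff (p x4) (p x1) = r1 * rp1_diff x4 x1" "rp1_diff (p x3) (p x2) = r2 * rp1_diff x3 x2"
        "rp1_diff (p x2) (p x1) = r3 * rp1_diff x2 x1" "rp1_diff (p x3) (p x4) = r4 * rp1_diff x3 x4"
      using slope ln by metis
    have "cross_ratio (p x1) (p x2) (p x3) (p x4) = (r1 * r2) / (r3 * r4) * cross_ratio x1 x2 x3 x4"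
      unfolding cross_ratio_def d by (simp add: mult_ac)
    then have "\<bar>cross_ratio (p x1) (p x2) (p x3) (p x4)\<bar> = (r1 * r2) / (r3 * r4)"
      using r cr by (simp add: abs_mult)
    then have "ln \<bar>cross_ratio (p x1) (p x2) (p x3) (p x4)\<bar> = ln r1 + ln r2 - (ln r3 + ln r4)"
      using r by (simp add: ln_div ln_mult)
    then show "ereal \<bar>ln \<bar>cross_ratio (p x1) (p x2) (p x3) (p x4)\<bar>\<bar> \<le> ereal (4 * shear k 1)"
      using r L_def by simp
  qed
  have b: "boundary_shear k 1 = exp L" "boundary_shear k (- 1) = - exp (- L)" "boundary_shear k 0 = 0"
    using boundary_shear_eq[OF k'] by (simp_all add: L_def)
  \<comment> \<open>The quadruple is symmetric about 0, so the two finite differences take the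
    opposite slopes \<open>exp (- L)\<close> and \<open>exp L\<close>.\<close>
  let ?Q = "(None, Some (- 1), Some 0, Some 1) :: real option \<times> real option \<times> real option \<times> real option"
  have "cross_ratio (p None) (p (Some (- 1))) (p (Some 0)) (p (Some 1)) = - exp (- 2 * L)"
    by (simp add: p_def b cross_ratio_def exp_minus field_simps flip: exp_add)
  then have "ereal (2 * shear k 1) =
      ereal \<bar>ln \<bar>cross_ratio (p None) (p (Some (- 1))) (p (Some 0)) (p (Some 1))\<bar>\<bar>"
    using L by (simp add: L_def)
  also have "\<dots> \<le> cross_ratio_norm p"
    unfolding cross_ratio_norm_def by (rule SUP_upper2[of ?Q]) (auto simp: cross_ratio_def)
  finally show "ereal (2 * shear k 1) \<le> cross_ratio_norm p" .
qed

lemma quasisymmetric_boundary_shear: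
  assumes "0 \<le> k" "k < 1" shows "quasisymmetric (map_option (boundary_shear k))"
  unfolding quasisymmetric_def
  using orientation_preserving_boundary_shear[OF assms] cross_ratio_norm_boundary_shear(2)[OF assms]
  by (auto intro: order_le_less_trans)

section \<open>Lower bound for the maximal dilatation\<close>

text \<open>At the fixed point \<open>\<i>\<close> the differential is a Euclidean shear of strength
  \<open>t\<close>: it sends 1 to a vector of length at least \<open>t\<close> and fixes
  \<open>\<i>\<close>.\<close>

lemma max_dilatation_shear_map_ge:
  assumes k: "0 \<le> k" "k < 1"
  shows "ereal (2 * k / sqrt (1 - k\<^sup>2)) \<le> max_dilatation (shear_map k)"
proof -
  have k': "\<bar>k\<bar> < 1" using k by simp
  have i: "\<i> \<in> H2" by (simp add: H2_def)
  define t where "t = 2 * k / sqrt (1 - k\<^sup>2)"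
  have t: "0 \<le> t" using k by (simp add: t_def abs_square_le_1)
  have tw: "twist k \<i> = - t" by (simp add: twist_def t_def)
  have fi: "shear_map k \<i> = \<i>" using shear_antiderivative(1)[OF k'] by (simp add: shear_map_def)
  define D where "D = shear_deriv k \<i>"
  have D: "D v = v + \<i> * of_real (t * Re v)" for v
    by (simp add: D_def shear_deriv_def fi tw complex_eq_iff)
  \<comment> \<open>The inverse shear has norm at most \<open>1 + t\<close>. This keeps the minor
    axis positive, so that the quotient of the axes is not a division by zero.\<close>
  have low: "1 / (1 + t) \<le> norm (D v)" if "norm v = 1" for v
  proof -
    have "1 = norm (D v - \<i> * of_real (t * Re (D v)))" using that by (simp add: D)
    also have "\<dots> \<le> norm (D v) + t * \<bar>Re (D v)\<bar>"
      using norm_triangle_ineq4[of "D v" "\<i> * of_real (t * Re (D v))"] t by (simp add: norm_mult abs_mult)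
    also have "\<dots> \<le> norm (D v) + t * norm (D v)"
      using t abs_Re_le_cmod[of "D v"] by (simp add: mult_left_mono)
    finally show ?thesis using t by (simp add: divide_simps algebra_simps)
  qed
  have up: "norm (D v) \<le> 1 + t" if "norm v = 1" for v
  proof -
    have "norm (D v) \<le> norm v + t * \<bar>Re v\<bar>"
      using norm_triangle_ineq[of v "\<i> * of_real (t * Re v)"] t by (simp add: D norm_mult abs_mult)
    also have "\<dots> \<le> 1 + t * 1"
      using t abs_Re_le_cmod[of v] that by (intro add_mono mult_left_mono) auto
    finally show ?thesis by simp
  qed
  let ?E = "D ` sphere 0 1"
  have "norm (D 1) \<le> (SUP w\<in>?E. norm w)"
    by (rule cSUP_upper) (auto intro!: bdd_aboveI[of _ "1 + t"] up)
  moreover have "t \<le> norm (D 1)" using abs_Im_le_cmod[of "D 1"] t by (simp add: D)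
  ultimately have major: "2 * t \<le> major_axis ?E" by (simp add: major_axis_def)
  have "(INF w\<in>?E. norm w) \<le> norm (D \<i>)"
    by (rule cINF_lower) (auto intro!: bdd_belowI[of _ 0])
  then have minor: "minor_axis ?E \<le> 2" by (simp add: minor_axis_def D)
  have "1 / (1 + t) \<le> (INF w\<in>?E. norm w)"
    by (rule cINF_greatest) (auto intro!: low exI[of _ 1])
  then have pos: "0 < minor_axis ?E"
    using t by (auto simp: minor_axis_def intro: order_less_le_trans[of 0 "1 / (1 + t)"])
  have "t \<le> major_axis ?E / minor_axis ?E"
    using frac_le[OF _ major pos minor] major t by simp
  also have "ereal \<dots> \<le> max_dilatation (shear_map k)"
    unfolding max_dilatation_def
    by (rule SUP_upper2[OF i]) (simp add: diff_at_shear_map[OF k' i] D_def)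
  finally show ?thesis by (simp add: t_def)
qed

section \<open>Growth of the total shear\<close>

lemma arsinh_scaled_has_derivative:
  assumes "0 < (e::real)"
  shows "((\<lambda>w. arsinh (w / e)) has_real_derivative 1 / sqrt (e\<^sup>2 + w\<^sup>2)) (at w)"
proof -
  have "sqrt ((w / e)\<^sup>2 + 1) = sqrt (e\<^sup>2 + w\<^sup>2) / e"
    using assms by (intro real_sqrt_unique) (auto simp: power_divide field_simps)
  moreover have "((\<lambda>w. arsinh (w / e)) has_real_derivative 1 / sqrt ((w / e)\<^sup>2 + 1) * (1 / e)) (at w)"
  proof -
    have "((\<lambda>w. w / e) has_real_derivative 1 / e) (at w)"
      by (rule DERIV_cdivide[OF DERIV_ident])
    from DERIV_chain2[OF arsinh_real_has_field_derivative this] show ?thesis .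
  qed
  ultimately show ?thesis using assms by simp
qed

text \<open>With \<open>e = sqrt (1 - k\<^sup>2)\<close> the density is comparable to
  \<open>1 / sqrt (e\<^sup>2 + w\<^sup>2)\<close>, whose primitive is \<open>arsinh (w / e)\<close>.
  The lower comparison stops at 1/2 because the density vanishes at 1; monotonicity of
  \<open>shear k\<close> covers the rest.\<close>

lemma shear_one_bounds:
  assumes k: "0 < k" "k < 1" and e: "0 < e" "k\<^sup>2 + e\<^sup>2 = 1"
  shows "shear k 1 \<le> 2 * arsinh (1 / e)" and "k / 2 * arsinh (1 / (2 * e)) \<le> shear k 1"
proof -
  have k': "\<bar>k\<bar> < 1" using k by simp
  note arsinh_deriv = arsinh_scaled_has_derivative[OF e(1)]
  have denom: "1 - k\<^sup>2 * (1 - w\<^sup>2)\<^sup>2 = e\<^sup>2 + k\<^sup>2 * w\<^sup>2 * (2 - w\<^sup>2)" for w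
    using e(2) by algebra
  have w1: "w\<^sup>2 \<le> 1" if "0 \<le> w" "w \<le> 1" for w :: real
    using that by (simp add: abs_square_le_1)
  have S: "0 < sqrt (e\<^sup>2 + w\<^sup>2)" for w using e(1) by (simp add: add_pos_nonneg)
  have density: "shear_density k w = 2 * k * sqrt (1 - w\<^sup>2) / sqrt (e\<^sup>2 + k\<^sup>2 * w\<^sup>2 * (2 - w\<^sup>2))"
    if "0 \<le> w" "w \<le> 1" for w
    using w1[OF that] by (simp add: shear_density_def denom[symmetric])
  have upper: "shear_density k w \<le> 2 / sqrt (e\<^sup>2 + w\<^sup>2)" if w: "0 \<le> w" "w \<le> 1" for w
  proof -
    have "k\<^sup>2 \<le> 1" using k by (simp add: abs_square_le_1)
    \<comment> \<open>Uses \<open>k\<^sup>2 \<le> 1\<close> for the first summand and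
      \<open>1 \<le> 2 - w\<^sup>2\<close> for the second.\<close>
    then have "k\<^sup>2 * (e\<^sup>2 + w\<^sup>2) \<le> e\<^sup>2 + k\<^sup>2 * w\<^sup>2 * (2 - w\<^sup>2)"
      using w1[OF w] mult_right_mono[of "k\<^sup>2" 1 "e\<^sup>2"] mult_left_mono[of "1" "2 - w\<^sup>2" "k\<^sup>2 * w\<^sup>2"]
      by (simp add: algebra_simps)
    then have "k * sqrt (e\<^sup>2 + w\<^sup>2) \<le> sqrt (e\<^sup>2 + k\<^sup>2 * w\<^sup>2 * (2 - w\<^sup>2))"
      using k by (metis abs_of_pos real_sqrt_abs real_sqrt_le_iff real_sqrt_mult)
    then have "shear_density k w \<le> (2 * k) / (k * sqrt (e\<^sup>2 + w\<^sup>2))"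
      unfolding density[OF w] using k S[of w] w1[OF w] by (intro frac_le) auto
    then show ?thesis using k by simp
  qed
  have lower: "k / 2 * (1 / sqrt (e\<^sup>2 + w\<^sup>2)) \<le> shear_density k w" if w: "0 \<le> w" "w \<le> 1 / 2" for w
  proof -
    have w2: "w\<^sup>2 \<le> (1 / 2)\<^sup>2" using w by (intro power_mono) auto
    have k2: "k\<^sup>2 \<le> 1" using k by (simp add: abs_square_le_1)
    have "k\<^sup>2 * (w\<^sup>2 * (2 - w\<^sup>2)) \<le> 1 * (w\<^sup>2 * 2)"
      using w2 k2 by (intro mult_mono) (auto simp: power2_eq_square)
    then have "e\<^sup>2 + k\<^sup>2 * w\<^sup>2 * (2 - w\<^sup>2) \<le> e\<^sup>2 + 1 * (w\<^sup>2 * 2)"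
      unfolding mult.assoc by (rule add_left_mono)
    also have "\<dots> \<le> 4 * (e\<^sup>2 + w\<^sup>2)"
      by simp
    finally have "e\<^sup>2 + k\<^sup>2 * w\<^sup>2 * (2 - w\<^sup>2) \<le> 4 * (e\<^sup>2 + w\<^sup>2)" .
    then have "sqrt (e\<^sup>2 + k\<^sup>2 * w\<^sup>2 * (2 - w\<^sup>2)) \<le> sqrt (4 * (e\<^sup>2 + w\<^sup>2))" by simp
    then have d: "sqrt (e\<^sup>2 + k\<^sup>2 * w\<^sup>2 * (2 - w\<^sup>2)) \<le> 2 * sqrt (e\<^sup>2 + w\<^sup>2)" unfolding real_sqrt_mult by simp
    have "(1 / 2)\<^sup>2 \<le> 1 - w\<^sup>2" using w2 by (simp add: power2_eq_square)
    then have n: "1 / 2 \<le> sqrt (1 - w\<^sup>2)" by (rule real_le_rsqrt)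
    have pos: "0 < sqrt (e\<^sup>2 + k\<^sup>2 * w\<^sup>2 * (2 - w\<^sup>2))"
      using e(1) w2 by (auto intro!: add_pos_nonneg simp: power2_eq_square)
    have "k / (2 * sqrt (e\<^sup>2 + w\<^sup>2)) \<le> (2 * k * sqrt (1 - w\<^sup>2)) / sqrt (e\<^sup>2 + k\<^sup>2 * w\<^sup>2 * (2 - w\<^sup>2))"
      using k n d pos by (intro frac_le) (auto intro!: mult_nonneg_nonneg order_trans[OF _ n] simp del: real_sqrt_ge_0_iff)
    then show ?thesis using density[of w] w by simp
  qed
  \<comment> \<open>The integrals are compared through the monotone difference of the two
    primitives.\<close>
  have "2 * arsinh (0 / e) - shear k 0 \<le> 2 * arsinh (1 / e) - shear k 1"
  proof (rule DERIV_nonneg_imp_nondecreasing[where f = "\<lambda>w. 2 * arsinh (w / e) - shear k w"])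
    fix w :: real assume w: "0 \<le> w" "w \<le> 1"
    have "((\<lambda>w. 2 * arsinh (w / e) - shear k w) has_real_derivative
        2 * (1 / sqrt (e\<^sup>2 + w\<^sup>2)) - shear_density k w) (at w)"
      by (intro DERIV_diff DERIV_cmult arsinh_deriv shear_antiderivative(2)[OF k'])
    then show "\<exists>y. ((\<lambda>w. 2 * arsinh (w / e) - shear k w) has_real_derivative y) (at w) \<and> 0 \<le> y"
      using upper[OF w] by auto
  qed simp
  then show "shear k 1 \<le> 2 * arsinh (1 / e)" using shear_antiderivative(1)[OF k'] by simp
  have "shear k 0 - k / 2 * arsinh (0 / e) \<le> shear k (1 / 2) - k / 2 * arsinh ((1 / 2) / e)"
  proof (rule DERIV_nonneg_imp_nondecreasing[where f = "\<lambda>w. shear k w - k / 2 * arsinh (w / e)"])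
    fix w :: real assume w: "0 \<le> w" "w \<le> 1 / 2"
    have "((\<lambda>w. shear k w - k / 2 * arsinh (w / e)) has_real_derivative
        shear_density k w - k / 2 * (1 / sqrt (e\<^sup>2 + w\<^sup>2))) (at w)"
      by (intro DERIV_diff DERIV_cmult arsinh_deriv shear_antiderivative(2)[OF k'])
    then show "\<exists>y. ((\<lambda>w. shear k w - k / 2 * arsinh (w / e)) has_real_derivative y) (at w) \<and> 0 \<le> y"
      using lower[OF w] by (intro exI conjI) auto
  qed simp
  moreover have "shear k (1 / 2) \<le> shear k 1" using k by (intro shear_mono) auto
  ultimately show "k / 2 * arsinh (1 / (2 * e)) \<le> shear k 1"
    using shear_antiderivative(1)[OF k'] by simp
qed

text \<open>For \<open>x \<ge> 3\<close> the argument of the logarithm is at most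
  \<open>2 * x + 1\<close>, hence at most the square of \<open>x\<close>.\<close>

lemma arsinh_le_2_ln:
  fixes x :: real
  assumes "3 \<le> x" shows "arsinh x \<le> 2 * ln x"
proof -
  have "sqrt (x\<^sup>2 + 1) \<le> x + 1" using assms by (intro real_le_lsqrt) (auto simp: power2_eq_square algebra_simps)
  moreover have "2 * x + 1 \<le> x * x" using assms mult_right_mono[of 3 x x] by linarith
  ultimately have "x + sqrt (x\<^sup>2 + 1) \<le> x * x" by linarith
  then have "arsinh x \<le> ln (x * x)"
    unfolding arsinh_real_def using assms arsinh_real_aux[of x] by (subst ln_le_cancel_iff) auto
  then show ?thesis using assms by (simp add: ln_mult)
qed

section \<open>Contradiction with sublinear growth\<close>

theorem corollary3:
  shows "\<not> (\<exists>F :: real \<Rightarrow> real.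
           (\<forall>t\<ge>0. F t \<ge> 0) \<and>
           ((\<lambda>t. F t / t) \<longlongrightarrow> 0) at_top \<and>
           (\<forall>\<phi> f. quasisymmetric \<phi> \<longrightarrow> minimal_lagrangian f \<longrightarrow> extends_continuously f \<phi> \<longrightarrow>
              ereal_ln (max_dilatation f) \<le> ereal (F (real_of_ereal (cross_ratio_norm \<phi>)))))"
proof clarify
  fix F :: "real \<Rightarrow> real"
  assume lim: "((\<lambda>t. F t / t) \<longlongrightarrow> 0) at_top"
    and bound: "\<forall>\<phi> f. quasisymmetric \<phi> \<longrightarrow> minimal_lagrangian f \<longrightarrow> extends_continuously f \<phi> \<longrightarrow>
              ereal_ln (max_dilatation f) \<le> ereal (F (real_of_ereal (cross_ratio_norm \<phi>)))"
  \<comment> \<open>The constant combines \<open>t \<le> 4 * L\<close> with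
    \<open>L \<le> 4 * ln x\<close>: then \<open>t / 16\<close> is at most
    \<open>ln x\<close>.\<close>
  have "eventually (\<lambda>t. F t / t < 1 / 16) at_top"
    using lim by (rule order_tendstoD) simp
  then obtain T where T: "\<And>t. T \<le> t \<Longrightarrow> F t / t < 1 / 16"
    by (auto simp: eventually_at_top_linorder)
  \<comment> \<open>\<open>x = 2 * sinh M\<close> makes \<open>arsinh (1 / (2 * e))\<close> equal to
    \<open>M\<close>. The three entries of the maximum ensure that \<open>t\<close> is positive,
    that \<open>T \<le> t\<close> (from \<open>M / 2 \<le> 2 * L \<le> t\<close>), and that
    \<open>3 \<le> x\<close>.\<close>
  define M where "M = max (max 1 (2 * T)) (arsinh (3 / 2))"
  define x where "x = 2 * sinh M"
  have "sinh (arsinh (3 / 2)) \<le> sinh M" by (subst sinh_real_le_iff) (simp add: M_def)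
  then have x: "3 \<le> x" by (simp add: x_def)
  define e where "e = 1 / x"
  define k where "k = sqrt (1 - e\<^sup>2)"
  have e: "0 < e" "e \<le> 1 / 3" using x by (auto simp: e_def field_simps)
  have e2: "e\<^sup>2 \<le> (1 / 3)\<^sup>2" using e by (intro power_mono) auto
  have k2: "k\<^sup>2 + e\<^sup>2 = 1" using e2 by (simp add: k_def power2_eq_square)
  have k_half: "1 / 2 \<le> k" unfolding k_def using e2 by (intro real_le_rsqrt) (simp add: power2_eq_square)
  have k1: "k < 1" unfolding k_def using e by simp
  have k: "0 < k" "0 \<le> k" "\<bar>k\<bar> < 1" using k_half k1 by auto
  define L where "L = shear k 1"
  have "L \<le> 2 * arsinh x"
    using shear_one_bounds(1)[OF k(1) k1 e(1) k2] by (simp add: L_def e_def)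
  then have L_upper: "L \<le> 4 * ln x" using arsinh_le_2_ln[OF x] by simp
  have "arsinh (1 / (2 * e)) = M" by (simp add: e_def x_def arsinh_sinh_real)
  then have "k / 2 * M \<le> L"
    using shear_one_bounds(2)[OF k(1) k1 e(1) k2] by (simp add: L_def)
  moreover have "(1 / 2) / 2 * M \<le> k / 2 * M"
    using k_half by (intro mult_right_mono) (auto simp: M_def)
  ultimately have L_lower: "M / 2 \<le> 2 * L" by simp
  let ?\<phi> = "map_option (boundary_shear k)"
  define t where "t = real_of_ereal (cross_ratio_norm ?\<phi>)"
  note norm = cross_ratio_norm_boundary_shear[OF k(2) k1, folded L_def]
  \<comment> \<open>The two bounds make the norm finite, so \<open>real_of_ereal\<close> returns its
    true value.\<close>
  have "cross_ratio_norm ?\<phi> = ereal t"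
    using norm by (cases "cross_ratio_norm ?\<phi>") (auto simp: t_def)
  with norm have t: "2 * L \<le> t" "t \<le> 4 * L" by simp_all
  then have "T \<le> t" "0 < t" using L_lower by (auto simp: M_def)
  with T[of t] have "F t < t / 16" by (simp add: field_simps)
  with t(2) L_upper have "F t < ln x" by simp
  moreover have "ereal (ln x) \<le> ereal_ln (max_dilatation (shear_map k))"
  proof -
    have "sqrt (1 - k\<^sup>2) = e" using k2 e(1) by (simp add: real_sqrt_unique)
    then have "ereal (2 * k / e) \<le> max_dilatation (shear_map k)"
      using max_dilatation_shear_map_ge[OF k(2) k1] by simp
    \<comment> \<open>As \<open>e = 1 / x\<close> and \<open>k \<ge> 1/2\<close>, the dilatation is
      at least \<open>x\<close>; its logarithm thus exceeds \<open>F t\<close>.\<close>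
    moreover have "x \<le> 2 * k / e" using k_half x mult_right_mono[of 1 "2 * k" x] by (simp add: e_def)
    ultimately have "ereal x \<le> max_dilatation (shear_map k)"
      by (meson ereal_less_eq(3) order_trans)
    then show ?thesis
      using x by (cases "max_dilatation (shear_map k)") (auto simp: ereal_ln_def)
  qed
  moreover have "ereal_ln (max_dilatation (shear_map k)) \<le> ereal (F t)"
    unfolding t_def using bound quasisymmetric_boundary_shear[OF k(2) k1]
      minimal_lagrangian_shear_map[OF k(3)] shear_map_extends_continuously[OF k(3)] by blast
  ultimately show False by (metis ereal_less_eq(3) not_less order_trans)
qed

end
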